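(* Let $\mu_0 \in GMM_d(K_0)$ and $\mu_1 \in GMM_d(K_1)$ be two Gaussian mixtures on $\mathbb{R}^d$, written $\mu_i=\sum_{k=1}^{K_i}\pi_i^k\,\mathcal{N}(m_i^k,\Sigma_i^k)$ for $i=0,1$, with $\pi_i^k\ge0$ and $\sum_k\pi_i^k=1$. Then $$W_2(\mu_0,\mu_1) \leq MW_2(\mu_0,\mu_1) \leq W_2(\mu_0,\mu_1) + \sum_{i=0,1}\left(2\sum_{k=1}^{K_i} \pi_i^k\, \mathrm{trace}(\Sigma_i^k)\right)^{\frac 1 2}.$$ The left-hand side inequality is attained (i.e. is an equality) when for instance: (i) $\mu_0$ and $\mu_1$ are both composed of only one Gaussian component; (ii) $\mu_0$ and $\mu_1$ are finite linear combinations of Dirac masses; (iii) $\mu_1$ is obtained from $\mu_0$ by an affine transformation.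
   Context: $d\ge1$ is an integer. Gaussian distributions $\mathcal{N}(m,\Sigma)$ on $\mathbb{R}^n$ may be degenerate (Dirac masses are included). $GMM_n(K)$ is the set of probability measures on $\mathbb{R}^n$ that can be written $\sum_{k=1}^{K}\pi_k\mathcal{N}(m_k,\Sigma_k)$ with $\pi_k\ge0$, $\sum_k\pi_k=1$, and $GMM_n(\infty)=\bigcup_K GMM_n(K)$. $\Pi(\mu_0,\mu_1)$ is the set of probability measures on $\mathbb{R}^d\times\mathbb{R}^d$ with marginals $\mu_0,\mu_1$, and $W_2(\mu_0,\mu_1)\ge0$ is defined by $W_2^2(\mu_0,\mu_1)=\inf_{\gamma\in\Pi(\mu_0,\mu_1)}\int\|y_0-y_1\|^2d\gamma(y_0,y_1)$. For finite Gaussian mixtures $\mu_0,\mu_1$ on $\mathbb{R}^d$, $MW_2(\mu_0,\mu_1)\ge0$ is defined by $$MW_2^2(\mu_0,\mu_1) := \inf_{\gamma \in \Pi(\mu_0,\mu_1) \cap GMM_{2d}(\infty)} \int_{\mathbb{R}^d\times\mathbb{R}^d} \|y_0-y_1\|^2d\gamma(y_0,y_1),$$ where $\mathbb{R}^d\times\mathbb{R}^d$ is identified with $\mathbb{R}^{2d}$.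
   Formalization: Item (iii) fails for general affine maps (e.g. x ↦ -x on ½δ_0+½N(1,1)); it is proved for affine transformations x ↦ Ax+b with A symmetric positive semidefinite, and for any affine transformation that is an optimal transport map from μ_0 to μ_1. *)

theory Defs
  imports "HOL-Probability.Probability"
begin

definition std_gaussian :: "'a::euclidean_space measure" where
  "std_gaussian = density lborel (\<lambda>x. ennreal (\<Prod>b\<in>Basis. std_normal_density (x \<bullet> b)))"

(* The possibly degenerate Gaussian N(m, S): the law of m + A Z, where Z is standard
   normal and A A^T = S.  The covariance S is given as a linear operator, so that the
   same definition serves on R^d and on the Euclidean space R^d x R^d; on R^d it is
   the operator of the covariance matrix.  An A with A A^T = S exists exactly when S is
   linear, symmetric and positive semidefinite; S = 0 gives the Dirac mass at m. *)
definition is_gaussian :: "'a::euclidean_space measure \<Rightarrow> 'a \<Rightarrow> ('a \<Rightarrow> 'a) \<Rightarrow> bool" where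
  "is_gaussian \<mu> m S \<longleftrightarrow>
     (\<exists>A :: 'a \<Rightarrow> 'a. linear A \<and> S = A \<circ> adjoint A \<and> \<mu> = distr std_gaussian borel (\<lambda>z. m + A z))"

definition is_gaussian_mixture ::
  "'a::euclidean_space measure \<Rightarrow> nat \<Rightarrow> (nat \<Rightarrow> real) \<Rightarrow> (nat \<Rightarrow> 'a) \<Rightarrow> (nat \<Rightarrow> 'a \<Rightarrow> 'a) \<Rightarrow> bool" where
  "is_gaussian_mixture \<mu> K \<pi> m S \<longleftrightarrow>
     sets \<mu> = sets borel \<and> (\<forall>k<K. 0 \<le> \<pi> k) \<and> (\<Sum>k<K. \<pi> k) = 1 \<and>
     (\<exists>\<nu>. (\<forall>k<K. is_gaussian (\<nu> k) (m k) (S k)) \<and>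
          (\<forall>B\<in>sets borel. emeasure \<mu> B = (\<Sum>k<K. ennreal (\<pi> k) * emeasure (\<nu> k) B)))"

definition GMM :: "nat \<Rightarrow> 'a::euclidean_space measure set" where
  "GMM K = {\<mu>. \<exists>\<pi> m S. is_gaussian_mixture \<mu> K \<pi> m S}"

definition GMM_fin :: "'a::euclidean_space measure set" where
  "GMM_fin = (\<Union>K. GMM K)"

definition couplings ::
  "'a::euclidean_space measure \<Rightarrow> 'a measure \<Rightarrow> ('a \<times> 'a) measure set" where
  "couplings \<mu>0 \<mu>1 =
     {\<gamma>. prob_space \<gamma> \<and> sets \<gamma> = sets borel \<and> distr \<gamma> borel fst = \<mu>0 \<and> distr \<gamma> borel snd = \<mu>1}"

definition transport_cost :: "('a::euclidean_space \<times> 'a) measure \<Rightarrow> ennreal" where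
  "transport_cost \<gamma> = (\<integral>\<^sup>+ y. ennreal ((norm (fst y - snd y))\<^sup>2) \<partial>\<gamma>)"

(* enn2real sends an infinite infimum to 0.  For finite Gaussian mixtures both infima below
   are finite: the product coupling is itself a Gaussian mixture, of finite cost. *)
definition W2 :: "'a::euclidean_space measure \<Rightarrow> 'a measure \<Rightarrow> real" where
  "W2 \<mu>0 \<mu>1 = sqrt (enn2real (INF \<gamma>\<in>couplings \<mu>0 \<mu>1. transport_cost \<gamma>))"

definition MW2 :: "'a::euclidean_space measure \<Rightarrow> 'a measure \<Rightarrow> real" where
  "MW2 \<mu>0 \<mu>1 = sqrt (enn2real (INF \<gamma>\<in>couplings \<mu>0 \<mu>1 \<inter> GMM_fin. transport_cost \<gamma>))"

definition dirac_combination :: "'a::euclidean_space measure \<Rightarrow> bool" where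
  "dirac_combination \<mu> \<longleftrightarrow>
     sets \<mu> = sets borel \<and>
     (\<exists>X c. finite X \<and> (\<forall>B\<in>sets borel. measure \<mu> B = (\<Sum>x\<in>X. c x * indicator B x)))"

definition psd_matrix :: "real^'n^'n \<Rightarrow> bool" where
  "psd_matrix A \<longleftrightarrow> transpose A = A \<and> (\<forall>x. 0 \<le> x \<bullet> (A *v x))"

(* The map T sends \<mu>0 to \<mu>1, and its plan (id, T)#\<mu>0 is optimal for W2. *)
definition optimal_transport_map ::
  "('a::euclidean_space \<Rightarrow> 'a) \<Rightarrow> 'a measure \<Rightarrow> 'a measure \<Rightarrow> bool" where
  "optimal_transport_map T \<mu>0 \<mu>1 \<longleftrightarrow>
     T \<in> borel_measurable borel \<and> distr \<mu>0 borel T = \<mu>1 \<and>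
     transport_cost (distr \<mu>0 borel (\<lambda>x. (x, T x))) =
       (INF \<gamma>\<in>couplings \<mu>0 \<mu>1. transport_cost \<gamma>)"

end

theory Submission
  imports Defs
begin

text \<open>
  A coupling that is a Gaussian mixture is in particular a coupling, so \<open>W2\<close> is at most \<open>MW2\<close>; all
  that needs attention is that both infima are finite.

  The upper bound rests on a resampling argument. Let \<open>(y0, y1)\<close> follow a coupling of cost close to the optimum.
  Draw labels \<open>i\<close>, \<open>j\<close> from their posterior laws given \<open>y0\<close> and \<open>y1\<close>, then forget the two points and draw
  new independent ones, \<open>x0\<close> and \<open>x1\<close>, from the components with labels \<open>i\<close> and \<open>j\<close>. The law of \<open>(x0, x1)\<close> is a
  coupling of the two mixtures and is itself a finite Gaussian mixture. Given the label, \<open>x0\<close> and \<open>y0\<close> are two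
  independent copies of one Gaussian, so their mean squared distance is twice the trace of its
  covariance, and the triangle inequality in L2 along \<open>x0\<close>, \<open>y0\<close>, \<open>y1\<close>, \<open>x1\<close> is the claim. This is carried by
  \<open>coupling_label_weights\<close> and \<open>GMM_coupling_near_coupling\<close>. The triangle inequality is used in the
  equivalent form of a family of weighted bounds on squares, \<open>sqrt_le_of_weighted_bounds\<close>, so that
  only the linearity of the integral is needed.

  For the cases of equality it suffices to replace every coupling by a Gaussian mixture coupling that costs no more.
  For two Gaussians, the quadratic cost only sees the mean and the covariance of a coupling, and the
  Gaussian with this mean and covariance has the right marginals (\<open>gaussian_coupling_of_same_cost\<close>). That requires
  a square root of a positive semidefinite operator and the fact that a Gaussian law is determined by its mean and
  covariance; the latter is reduced to the invariance of the standard Gaussian under orthogonal maps, as two factors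
  \<open>L\<close>, \<open>M\<close> of one covariance operator differ by an orthogonal map of the source.
  A coupling of two finitely supported measures is finitely supported. For an affine map, the plan carried by
  its graph is a Gaussian mixture, so equality holds as soon as this plan is optimal; for a positive
  semidefinite linear part that follows from convex duality with explicit quadratic
  potentials (\<open>psd_affine_plan_optimal\<close>).
\<close>

section \<open>Linear algebra\<close>

lemma norm_square_eq_sum_Basis: "(norm x)\<^sup>2 = (\<Sum>b\<in>Basis. (x \<bullet> b)\<^sup>2)" for x :: "'a::euclidean_space"
  unfolding power2_norm_eq_inner by (subst euclidean_inner) (simp add: power2_eq_square)

text \<open>The map \<open>P u \<mapsto> Q u\<close> is a well-defined isometry from the range of \<open>P\<close> onto the range of \<open>Q\<close>,
  and it extends by an isometry between the orthogonal complements. Applied to adjoints, this is the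
  reason why a factor of a covariance operator is unique up to an orthogonal map.\<close>

lemma orthogonal_factor_of_norm_eq:
  fixes P Q :: "'a::euclidean_space \<Rightarrow> 'b::euclidean_space"
  assumes P: "linear P" and Q: "linear Q" and PQ: "\<And>u. norm (P u) = norm (Q u)"
  obtains U where "orthogonal_transformation U" "\<And>u. Q u = U (P u)"
proof -
  obtain h where h: "linear h" and Ph: "\<And>u. P (h (P u)) = P u"
    using linear_exists_right_inverse_on[OF P subspace_UNIV] by auto
  \<comment> \<open>A linear generalised inverse \<open>h\<close> of \<open>P\<close> gives a linear map sending each \<open>P u\<close> to \<open>Q u\<close>, isometric on the range of \<open>P\<close>.\<close>
  define g where "g = Q \<circ> h"
  have g: "linear g"
    unfolding g_def using h Q by (rule linear_compose)
  have gP: "g (P u) = Q u" for u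
  proof -
    have "norm (Q (h (P u) - u)) = norm (P (h (P u) - u))" using PQ by simp
    also have "\<dots> = 0" using Ph by (simp add: linear_diff[OF P])
    finally show ?thesis by (simp add: linear_diff[OF Q] g_def)
  qed
  define V where "V = range P"
  define W where "W = range Q"
  have V: "subspace V" and W: "subspace W"
    unfolding V_def W_def using P Q by (auto intro: linear_subspace_image)
  have norm_g: "norm (g x) = norm x" if "x \<in> V" for x
    using that gP PQ by (auto simp: V_def)
  have gV: "g ` V = W" by (auto simp: V_def W_def gP image_image)
  have "inj_on g V"
  proof (rule inj_onI)
    fix x y assume "x \<in> V" "y \<in> V" "g x = g y"
    then have "norm (g (x - y)) = 0" by (simp add: linear_diff[OF g])
    with norm_g[of "x - y"] show "x = y" using \<open>x \<in> V\<close> \<open>y \<in> V\<close> V by (simp add: subspace_diff)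
  qed
  then have dVW: "dim V = dim W"
    using dim_image_eq[OF g, of V] V gV by (simp add: span_eq_iff[THEN iffD2])
  define V' where "V' = {y. \<forall>x\<in>V. orthogonal x y}"
  define W' where "W' = {y. \<forall>x\<in>W. orthogonal x y}"
  have "subspace V'" "subspace W'"
    by (auto simp: V'_def W'_def subspace_orthogonal_to_vectors)
  moreover have "dim V' = dim W'"
    using dim_subspace_orthogonal_to_vectors[OF V subspace_UNIV]
      dim_subspace_orthogonal_to_vectors[OF W subspace_UNIV] dVW
    by (simp add: V'_def W'_def)
  \<comment> \<open>The ranges have equal dimension, hence so do their orthogonal complements.\<close>
  ultimately obtain k where k: "linear k" and kV: "k ` V' = W'" and norm_k: "\<And>x. x \<in> V' \<Longrightarrow> norm (k x) = norm x"
    using isometry_subspaces by metis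
  obtain B where B: "B \<subseteq> V" "pairwise orthogonal B" "\<And>x. x \<in> B \<Longrightarrow> norm x = 1"
     "independent B" "card B = dim V" "span B = V"
    using orthonormal_basis_subspace[OF V] by metis
  have finB: "finite B" using B(4) by (rule independent_imp_finite)
  \<comment> \<open>\<open>p\<close> is the orthogonal projection onto \<open>V\<close>.\<close>
  define p where "p x = (\<Sum>b\<in>B. (x \<bullet> b) *\<^sub>R b)" for x
  have p: "linear p"
    by (rule linearI) (simp_all add: p_def inner_add_left scaleR_add_left sum.distrib scaleR_sum_right)
  have pV: "p x \<in> V" for x
    unfolding p_def using B V by (intro subspace_sum subspace_scale) auto
  have pV': "x - p x \<in> V'" for x
  proof -
    have "orthogonal (x - p x) b" if b: "b \<in> B" for b
    proof -
      have "p x \<bullet> b = (\<Sum>c\<in>B. if c = b then x \<bullet> b else 0)"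
        unfolding p_def inner_sum_left
        using B b by (intro sum.cong) (auto simp: pairwise_def orthogonal_def norm_eq_1)
      then show ?thesis using b finB by (simp add: orthogonal_def inner_diff_left)
    qed
    then have "orthogonal (x - p x) y" if "y \<in> V" for y
      using orthogonal_to_span[of y B] that B(6) by blast
    then show ?thesis by (auto simp: V'_def orthogonal_commute)
  qed
  define U where "U x = g (p x) + k (x - p x)" for x
  have "linear (\<lambda>x. g (p x) + k (x - p x))"
    using linear_compose[OF p g] linear_compose[OF linear_compose_sub[OF linear_id[unfolded id_def] p] k]
    by (intro linear_compose_add) (auto simp: o_def)
  then have U: "linear U" by (simp add: U_def[abs_def])
  have "norm (U x) = norm x" for x
  proof -
    have 1: "orthogonal (g (p x)) (k (x - p x))"
      using gV kV pV[of x] pV'[of x] unfolding W'_def by blast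
    have 2: "orthogonal (p x) (x - p x)"
      using pV[of x] pV'[of x] unfolding V'_def by blast
    have "(norm (U x))\<^sup>2 = (norm (p x))\<^sup>2 + (norm (x - p x))\<^sup>2"
      unfolding U_def norm_add_Pythagorean[OF 1] norm_g[OF pV] norm_k[OF pV'] ..
    also have "\<dots> = (norm (p x + (x - p x)))\<^sup>2"
      by (rule norm_add_Pythagorean[OF 2, symmetric])
    finally show ?thesis by simp
  qed
  with U have "orthogonal_transformation U" by (simp add: orthogonal_transformation)
  moreover have "Q u = U (P u)" for u
  proof -
    have "P u - p (P u) \<in> V" using pV V by (intro subspace_diff) (auto simp: V_def)
    with pV'[of "P u"] have "P u - p (P u) = 0"
      unfolding V'_def by (auto simp: orthogonal_self)
    then have "p (P u) = P u" by simp
    then show ?thesis by (simp add: U_def gP linear_0[OF k])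
  qed
  ultimately show ?thesis by (rule that)
qed

text \<open>This provides a Gaussian with any prescribed covariance. Rank one pieces are split off one at a time,
  as in the Cholesky algorithm; the induction is on the codimension of the kernel.\<close>

lemma psd_operator_factor:
  fixes S :: "'a::euclidean_space \<Rightarrow> 'a"
  assumes "linear S" "\<And>u v. S u \<bullet> v = u \<bullet> S v" "\<And>u. 0 \<le> u \<bullet> S u"
  shows "\<exists>A :: 'a \<Rightarrow> 'a. linear A \<and> S = A \<circ> adjoint A"
  using assms
proof (induction "DIM('a) - dim {u. S u = 0}" arbitrary: S rule: less_induct)
  case less
  note S = less.prems
  show ?case
  proof (cases "\<forall>b. b \<bullet> S b = 0")
    case True
    \<comment> \<open>Polarisation in the direction \<open>u + S u\<close>: a symmetric operator with vanishing quadratic form is zero.\<close>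
    have "S u = 0" for u
    proof -
      have "(u + S u) \<bullet> S (u + S u) = 0" "u \<bullet> S u = 0" "S u \<bullet> S (S u) = 0" using True by auto
      then have "S u \<bullet> S u + u \<bullet> S (S u) = 0"
        by (simp add: linear_add[OF S(1)] inner_add_left inner_add_right)
      also have "u \<bullet> S (S u) = S u \<bullet> S u" by (metis S(2))
      finally show ?thesis by simp
    qed
    then show ?thesis
      by (intro exI[of _ "\<lambda>_. 0"]) (auto simp: linear_zero o_def)
  next
    case False
    then obtain b where b: "b \<bullet> S b > 0" using S(3) by (metis order_less_le)
    \<comment> \<open>Subtracting the rank one operator of \<open>v\<close> keeps \<open>S\<close> positive (Cauchy--Schwarz for \<open>S\<close>) and adds \<open>b\<close> to the kernel.\<close>
    define c where "c = b \<bullet> S b"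
    define v where "v = (1 / sqrt c) *\<^sub>R S b"
    define S' where "S' u = S u - (v \<bullet> u) *\<^sub>R v" for u
    have c: "c > 0" using b c_def by simp
    have vu: "v \<bullet> u = (b \<bullet> S u) / sqrt c" for u
      using S(2)[of b u] by (simp add: v_def)
    have vb: "v \<bullet> b = sqrt c"
      using c by (simp add: vu flip: c_def) (simp add: real_div_sqrt)
    have S'b: "S' b = 0" using c by (simp add: S'_def vb) (simp add: v_def)
    have linS': "linear S'"
      by (rule linearI) (simp_all add: S'_def linear_add[OF S(1)] linear_scale[OF S(1)] inner_add_right
          algebra_simps)
    have symS': "S' u \<bullet> w = u \<bullet> S' w" for u w
      using S(2)[of u w] by (simp add: S'_def inner_diff_left inner_diff_right inner_commute)
    have posS': "0 \<le> u \<bullet> S' u" for u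
    proof -
      define t where "t = (v \<bullet> u) / sqrt c"
      have "0 \<le> (u - t *\<^sub>R b) \<bullet> S (u - t *\<^sub>R b)" by (rule S(3))
      also have "\<dots> = u \<bullet> S u - t * (b \<bullet> S u) - t * (u \<bullet> S b) + t * t * c"
        by (simp add: linear_diff[OF S(1)] linear_scale[OF S(1)] inner_diff_left inner_diff_right
            c_def algebra_simps)
      also have "u \<bullet> S b = b \<bullet> S u" using S(2)[of b u] by (simp add: inner_commute)
      also have "b \<bullet> S u = t * c" using c by (simp add: t_def vu)
      also have "u \<bullet> S u - t * (t * c) - t * (t * c) + t * t * c = u \<bullet> S u - t * t * c" by simp
      also have "t * t * c = (v \<bullet> u) * (v \<bullet> u)" using c by (simp add: t_def)
      also have "u \<bullet> S u - (v \<bullet> u) * (v \<bullet> u) = u \<bullet> S' u"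
        by (simp add: S'_def inner_diff_right inner_commute)
      finally show ?thesis .
    qed
    have sub: "subspace {u. S u = 0}" "subspace {u. S' u = 0}"
      using linear_subspace_kernel S(1) linS' by blast+
    have "{u. S u = 0} \<subset> {u. S' u = 0}"
    proof
      show "{u. S u = 0} \<subseteq> {u. S' u = 0}" by (auto simp: S'_def vu)
      have "b \<in> {u. S' u = 0}" "b \<notin> {u. S u = 0}" using S'b b by auto
      then show "{u. S u = 0} \<noteq> {u. S' u = 0}" by blast
    qed
    then have "dim {u. S u = 0} < dim {u. S' u = 0}"
      using sub by (intro dim_psubset) (simp add: span_eq_iff[THEN iffD2])
    moreover have "dim {u. S' u = 0} \<le> DIM('a)" by (rule dim_subset_UNIV)
    ultimately have "DIM('a) - dim {u. S' u = 0} < DIM('a) - dim {u. S u = 0}" by linarith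
    from less.hyps[OF this linS' symS' posS']
    obtain A :: "'a \<Rightarrow> 'a" where A: "linear A" and S'A: "S' = A \<circ> adjoint A" by blast
    \<comment> \<open>The adjoint of \<open>A\<close> kills \<open>b\<close>, so \<open>A\<close> also has a kernel; a unit vector \<open>e\<close> in it is a free direction that can carry \<open>v\<close> without disturbing \<open>A\<close>.\<close>
    have "adjoint A b \<bullet> adjoint A b = b \<bullet> S' b"
      by (simp add: S'A adjoint_clauses[OF A] inner_commute)
    then have "adjoint A b = 0" using S'b by simp
    moreover have "b \<noteq> 0" using b by auto
    ultimately have "\<not> inj (adjoint A)"
      using linear_0[OF adjoint_linear[OF A]] by (metis injD)
    then have "\<not> inj A"
      using A linear_injective_imp_surjective by (metis inj_adjoint_iff_surj)
    then obtain e' where "e' \<noteq> 0" "A e' = 0"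
      using linear_injective_0[OF A] by blast
    define e where "e = sgn e'"
    have e: "A e = 0" "e \<bullet> e = 1"
      using \<open>e' \<noteq> 0\<close> \<open>A e' = 0\<close> linear_scale[OF A]
      by (simp_all add: e_def sgn_div_norm dot_square_norm power2_eq_square)
    define A2 where "A2 z = A z + (e \<bullet> z) *\<^sub>R v" for z
    have A2: "linear A2"
      by (rule linearI) (simp_all add: A2_def linear_add[OF A] linear_scale[OF A] inner_add_right algebra_simps)
    have adj: "adjoint A2 = (\<lambda>u. adjoint A u + (v \<bullet> u) *\<^sub>R e)"
      by (rule adjoint_unique)
        (simp add: A2_def inner_add_left inner_add_right adjoint_clauses[OF A] inner_commute)
    have "S u = A2 (adjoint A2 u)" for u
    proof -
      have "e \<bullet> adjoint A u = 0" by (simp add: adjoint_clauses[OF A] e)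
      then have "A2 (adjoint A2 u) = A (adjoint A u) + (v \<bullet> u) *\<^sub>R v"
        by (simp add: adj A2_def linear_add[OF A] linear_scale[OF A] e inner_add_right)
      also have "A (adjoint A u) = S' u" by (simp add: S'A)
      finally show ?thesis by (simp add: S'_def)
    qed
    then have "S = A2 \<circ> adjoint A2" by auto
    with A2 show ?thesis by blast
  qed
qed

lemma trace_eq_sum_Basis: "trace A = (\<Sum>e\<in>Basis. e \<bullet> (A *v e))" for A :: "real^'n^'n"
proof -
  have B: "(Basis :: (real^'n) set) = (\<lambda>i. axis i 1) ` UNIV" by (auto simp: Basis_vec_def)
  have "inj (\<lambda>i::'n. axis i (1::real))" by (auto simp: inj_on_def axis_eq_axis)
  then have "(\<Sum>e\<in>Basis. e \<bullet> (A *v e)) = (\<Sum>i\<in>UNIV. axis i 1 \<bullet> (A *v axis i 1))"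
    unfolding B by (simp add: sum.reindex)
  also have "\<dots> = trace A"
    by (simp add: trace_def inner_axis' matrix_vector_mult_basis column_def)
  finally show ?thesis ..
qed

section \<open>Invariance of the standard Gaussian\<close>

text \<open>Uniqueness of Haar measure on Euclidean space, normalised on the unit ball because that is
  the set which an orthogonal map visibly preserves.\<close>

lemma translation_invariant_eq_lborel:
  fixes M :: "'a::euclidean_space measure"
  assumes [measurable_cong]: "sets M = sets borel"
    and invariant: "\<And>a. distr M borel (\<lambda>x. x + a) = M"
    and ball: "emeasure M (ball 0 1) = emeasure lborel (ball (0::'a) 1)"
    and "sigma_finite_measure M"
  shows "M = lborel"
proof (rule measure_eqI)
  show "sets M = sets lborel" using assms(1) by simp
  interpret M: sigma_finite_measure M by fact
  interpret P: pair_sigma_finite M lborel ..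
  fix A assume "A \<in> sets M"
  then have A[measurable]: "A \<in> sets borel" using assms(1) by simp
  define B where "B = ball (0::'a) 1"
  have B[measurable]: "B \<in> sets borel" by (simp add: B_def)
  have [simp]: "space M = UNIV" using sets_eq_imp_space_eq[OF assms(1)] by simp
  \<comment> \<open>Fubini on \<open>M A * lborel B\<close>, with one translation in each order of integration, exchanges the roles of \<open>A\<close> and \<open>B\<close>.\<close>
  have lb: "lborel = distr lborel borel (\<lambda>y. y + x)" for x :: 'a
    using lborel_affine[of 1 x] by (simp add: add.commute density_1)
  have neg: "lborel = distr lborel borel (\<lambda>y. x - y)" for x :: 'a
    using lborel_affine[of "-1" x] by (simp add: density_1)
  have "emeasure M A * emeasure lborel B
      = (\<integral>\<^sup>+x. (\<integral>\<^sup>+y. indicator A x * indicator B y \<partial>lborel) \<partial>M)"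
    by (simp add: nn_integral_cmult nn_integral_multc A[folded assms(1)])
  also have "\<dots> = (\<integral>\<^sup>+x. (\<integral>\<^sup>+y. indicator A x * indicator B (y + x) \<partial>lborel) \<partial>M)"
  proof (rule nn_integral_cong)
    fix x :: 'a
    show "(\<integral>\<^sup>+y. indicator A x * indicator B y \<partial>lborel)
        = (\<integral>\<^sup>+y. indicator A x * indicator B (y + x) \<partial>lborel)"
      by (subst lb[of x], subst nn_integral_distr) auto
  qed
  also have "\<dots> = (\<integral>\<^sup>+y. (\<integral>\<^sup>+x. indicator A x * indicator B (y + x) \<partial>M) \<partial>lborel)"
    by (rule P.Fubini'[symmetric]) measurable
  also have "\<dots> = (\<integral>\<^sup>+y. (\<integral>\<^sup>+x. indicator A (x - y) * indicator B x \<partial>M) \<partial>lborel)"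
  proof (rule nn_integral_cong)
    fix y
    have "(\<integral>\<^sup>+x. indicator A (x - y) * indicator B x \<partial>M)
        = (\<integral>\<^sup>+x. indicator A (x - y) * indicator B x \<partial>distr M borel (\<lambda>x. x + y))"
      by (simp add: invariant)
    also have "\<dots> = (\<integral>\<^sup>+x. indicator A x * indicator B (y + x) \<partial>M)"
      by (subst nn_integral_distr) (auto simp: add.commute)
    finally show "(\<integral>\<^sup>+x. indicator A x * indicator B (y + x) \<partial>M)
       = (\<integral>\<^sup>+x. indicator A (x - y) * indicator B x \<partial>M)" ..
  qed
  also have "\<dots> = (\<integral>\<^sup>+x. (\<integral>\<^sup>+y. indicator A (x - y) * indicator B x \<partial>lborel) \<partial>M)"
    by (rule P.Fubini') measurable
  also have "\<dots> = (\<integral>\<^sup>+x. (\<integral>\<^sup>+y. indicator A y * indicator B x \<partial>lborel) \<partial>M)"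
  proof (rule nn_integral_cong)
    fix x :: 'a
    show "(\<integral>\<^sup>+y. indicator A (x - y) * indicator B x \<partial>lborel)
        = (\<integral>\<^sup>+y. indicator A y * indicator B x \<partial>lborel)"
      by (subst (2) neg[of x], subst nn_integral_distr) auto
  qed
  also have "\<dots> = emeasure lborel A * emeasure M B"
    by (simp add: nn_integral_cmult nn_integral_multc B[folded assms(1)])
  finally have "emeasure M A * emeasure lborel B = emeasure lborel A * emeasure lborel B"
    by (simp add: B_def ball)
  moreover have "emeasure lborel B \<noteq> 0"
  proof
    assume "emeasure lborel B = 0"
    then have "B \<in> null_sets lborel" by (auto simp: null_sets_def)
    moreover have "open B" "B \<noteq> {}" by (auto simp: B_def)
    ultimately show False
      using open_not_negligible negligible_iff_null_sets null_sets_completionI by blast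
  qed
  moreover have "emeasure lborel B \<noteq> \<infinity>"
    unfolding B_def using emeasure_lborel_ball_finite[of "0::'a" 1] by simp
  ultimately show "emeasure M A = emeasure lborel A"
    by (simp add: ennreal_mult_cancel_left mult.commute[of _ "emeasure lborel B"])
qed

lemma borel_measurable_linear:
  fixes f :: "'a::euclidean_space \<Rightarrow> 'b::euclidean_space"
  assumes "linear f"
  shows "f \<in> borel_measurable borel"
  using assms by (intro borel_measurable_continuous_onI linear_continuous_on) (simp add: linear_conv_bounded_linear)

lemma borel_measurable_fst_snd [measurable]:
  "fst \<in> borel_measurable (borel :: ('a::second_countable_topology \<times> 'b::second_countable_topology) measure)"
  "snd \<in> borel_measurable (borel :: ('a::second_countable_topology \<times> 'b::second_countable_topology) measure)"
  by (simp_all flip: borel_prod)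

lemma lborel_orthogonal_transformation:
  fixes U :: "'a::euclidean_space \<Rightarrow> 'a"
  assumes U: "orthogonal_transformation U"
  shows "distr lborel borel U = lborel"
proof (rule translation_invariant_eq_lborel)
  have linU: "linear U" and nU: "\<And>x. norm (U x) = norm x"
    using U by (auto simp: orthogonal_transformation)
  have [measurable]: "U \<in> borel_measurable borel"
    using linU by (intro borel_measurable_continuous_onI linear_continuous_on) (simp add: linear_conv_bounded_linear)
  have surjU: "surj U" using U by (rule orthogonal_transformation_surj)
  have pre: "U -` ball 0 r = ball 0 r" for r
    using nU by auto
  show "sets (distr lborel borel U) = sets borel" by simp
  show "distr (distr lborel borel U) borel (\<lambda>x. x + a) = distr lborel borel U" for a
  proof -
    obtain c where c: "a = U c" using surjU by (metis surjD)
    have lb: "lborel = distr lborel borel (\<lambda>y. y + c)"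
      using lborel_affine[of 1 c] by (simp add: add.commute density_1)
    have "distr (distr lborel borel U) borel (\<lambda>x. x + a) = distr lborel borel (\<lambda>x. U x + U c)"
      by (subst distr_distr) (auto simp: c o_def)
    also have "\<dots> = distr (distr lborel borel (\<lambda>y. y + c)) borel U"
      by (subst distr_distr) (auto simp: o_def linear_add[OF linU])
    finally show ?thesis by (simp flip: lb)
  qed
  show "emeasure (distr lborel borel U) (ball 0 1) = emeasure lborel (ball (0::'a) 1)"
    by (subst emeasure_distr) (auto simp: pre)
  show "sigma_finite_measure (distr lborel borel U)"
  proof
    show "\<exists>A. countable A \<and> A \<subseteq> sets (distr lborel borel U) \<and> \<Union> A = space (distr lborel borel U) \<and>
        (\<forall>a\<in>A. emeasure (distr lborel borel U) a \<noteq> \<infinity>)"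
    proof (intro exI[of _ "range (\<lambda>n::nat. ball 0 (real n))"] conjI ballI)
      show "\<Union> (range (\<lambda>n. ball (0::'a) (real n))) = space (distr lborel borel U)"
        by (simp add: set_eq_iff reals_Archimedean2)
      fix a assume "a \<in> range (\<lambda>n. ball (0::'a) (real n))"
      then obtain n :: nat where a: "a = ball 0 (real n)" by auto
      show "emeasure (distr lborel borel U) a \<noteq> \<infinity>"
        unfolding a using emeasure_lborel_ball_finite[of "0::'a" "real n"]
        by (subst emeasure_distr) (auto simp: pre)
    qed auto
  qed
qed

lemma prod_std_normal_density:
  fixes x :: "'a::euclidean_space"
  shows "(\<Prod>b\<in>Basis. std_normal_density (x \<bullet> b)) = (1 / sqrt (2 * pi)) ^ DIM('a) * exp (- (norm x)\<^sup>2 / 2)"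
proof -
  have "- (norm x)\<^sup>2 / 2 = (\<Sum>b\<in>Basis. - (x \<bullet> b)\<^sup>2 / 2)"
    by (simp add: norm_square_eq_sum_Basis sum_negf sum_divide_distrib)
  then show ?thesis
    unfolding std_normal_density_def prod.distrib by (simp add: exp_sum)
qed

lemma sets_std_gaussian [measurable_cong, simp]: "sets std_gaussian = sets borel"
  by (simp add: std_gaussian_def)

lemma space_std_gaussian [simp]: "space std_gaussian = UNIV"
  by (simp add: std_gaussian_def)

text \<open>The density depends on the norm only, and Lebesgue measure is invariant.\<close>

lemma std_gaussian_orthogonal_transformation:
  fixes U :: "'a::euclidean_space \<Rightarrow> 'a"
  assumes U: "orthogonal_transformation U"
  shows "distr std_gaussian borel U = std_gaussian"
proof -
  have nU: "\<And>x. norm (U x) = norm x" and [measurable]: "U \<in> borel_measurable borel"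
    using U by (auto simp: orthogonal_transformation intro: borel_measurable_linear)
  let ?g = "\<lambda>x::'a. ennreal (\<Prod>b\<in>Basis. std_normal_density (x \<bullet> b))"
  have "std_gaussian = density (distr lborel borel U) ?g"
    by (simp add: std_gaussian_def lborel_orthogonal_transformation[OF U])
  also have "\<dots> = distr (density lborel (\<lambda>x. ?g (U x))) borel U"
    by (rule density_distr) auto
  also have "(\<lambda>x. ?g (U x)) = ?g"
    by (simp add: prod_std_normal_density nU)
  finally show ?thesis by (simp add: std_gaussian_def)
qed

text \<open>The hypothesis says that the linear images \<open>L Z\<close> and \<open>M Z\<close> have equal covariance operators.
  The orthogonal map relating the two factors is absorbed by the invariance of the standard Gaussian.\<close>

lemma distr_std_gaussian_eqI:
  fixes L M :: "'b::euclidean_space \<Rightarrow> 'a::euclidean_space"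
  assumes L: "linear L" and M: "linear M"
    and eq: "\<And>u. norm (adjoint L u) = norm (adjoint M u)"
  shows "distr std_gaussian borel L = distr std_gaussian borel M"
proof -
  obtain U where U: "orthogonal_transformation U" and MU: "\<And>u. adjoint M u = U (adjoint L u)"
    using orthogonal_factor_of_norm_eq[OF adjoint_linear[OF L] adjoint_linear[OF M] eq] by metis
  have linU: "linear U" using U by (rule orthogonal_transformation_linear)
  \<comment> \<open>Passing to adjoints, \<open>L\<close> and \<open>M\<close> differ by the orthogonal map \<open>U\<close> on the source.\<close>
  have "L x \<bullet> y = M (U x) \<bullet> y" for x y
    by (metis L M MU U adjoint_works orthogonal_transformation_def)
  then have "L = M \<circ> U" by (intro ext) (metis comp_apply vector_eq_rdot)
  moreover have [measurable]: "M \<in> borel_measurable borel" "U \<in> borel_measurable borel"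
    using M linU by (auto intro: borel_measurable_linear)
  moreover have "distr std_gaussian borel (M \<circ> U) = distr (distr std_gaussian borel U) borel M"
    by (subst distr_distr) auto
  ultimately show ?thesis using std_gaussian_orthogonal_transformation[OF U] by simp
qed

lemma prob_space_std_gaussian: "prob_space (std_gaussian :: 'a::euclidean_space measure)"
proof
  have "emeasure (std_gaussian :: 'a measure) UNIV
      = (\<integral>\<^sup>+x. (\<Prod>b\<in>Basis. ennreal (std_normal_density (x \<bullet> b))) \<partial>(lborel :: 'a measure))"
    by (simp add: std_gaussian_def emeasure_density prod_ennreal)
  also have "\<dots> = (\<Prod>b\<in>(Basis :: 'a set). \<integral>\<^sup>+x. ennreal (std_normal_density x) \<partial>lborel)"
    by (rule nn_integral_lborel_prod) auto
  also have "(\<integral>\<^sup>+x. ennreal (std_normal_density x) \<partial>lborel) = 1"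
    by (simp add: nn_integral_eq_integral)
  finally show "emeasure std_gaussian (space (std_gaussian :: 'a measure)) = 1" by simp
qed

lemma std_gaussian_pair:
  "(std_gaussian :: 'a::euclidean_space measure) \<Otimes>\<^sub>M (std_gaussian :: 'b::euclidean_space measure) = std_gaussian"
proof -
  interpret S: prob_space "std_gaussian :: 'b measure" by (rule prob_space_std_gaussian)
  let ?g = "\<lambda>x. ennreal (\<Prod>b\<in>Basis. std_normal_density (x \<bullet> b))"
  have "(std_gaussian :: 'a measure) \<Otimes>\<^sub>M (std_gaussian :: 'b measure)
      = density (lborel \<Otimes>\<^sub>M lborel) (\<lambda>(x, y). ?g x * ?g y)"
    unfolding std_gaussian_def
    by (rule pair_measure_density)
      (auto simp: S.sigma_finite_measure lborel.sigma_finite_measure_axioms simp flip: std_gaussian_def)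
  also have "(\<lambda>(x::'a, y::'b). ?g x * ?g y) = ?g"
    by (auto simp: fun_eq_iff prod_std_normal_density norm_Pair power_add ennreal_mult[symmetric]
        add_divide_distrib exp_add[symmetric] algebra_simps)
  finally show ?thesis by (simp add: lborel_prod std_gaussian_def)
qed

lemma distr_pair_measure_marginals:
  fixes \<mu> :: "'a::second_countable_topology measure" and \<nu> :: "'b::second_countable_topology measure"
  assumes "prob_space \<mu>" "prob_space \<nu>" and s: "sets \<mu> = sets borel" "sets \<nu> = sets borel"
  shows "distr (\<mu> \<Otimes>\<^sub>M \<nu>) borel fst = \<mu>" "distr (\<mu> \<Otimes>\<^sub>M \<nu>) borel snd = \<nu>"
proof -
  interpret M: prob_space \<mu> by fact
  interpret N: prob_space \<nu> by fact
  interpret pair_sigma_finite \<mu> \<nu> ..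
  show "distr (\<mu> \<Otimes>\<^sub>M \<nu>) borel fst = \<mu>"
  proof -
    have "distr (\<mu> \<Otimes>\<^sub>M \<nu>) borel fst = distr (\<mu> \<Otimes>\<^sub>M \<nu>) \<mu> fst"
      using s by (intro distr_cong) auto
    then show ?thesis by (simp add: N.distr_pair_fst)
  qed
  show "distr (\<mu> \<Otimes>\<^sub>M \<nu>) borel snd = \<nu>"
  proof (rule measure_eqI)
    fix B assume "B \<in> sets (distr (\<mu> \<Otimes>\<^sub>M \<nu>) borel snd)"
    then have B: "B \<in> sets \<nu>" using s by simp
    have "emeasure (distr (\<mu> \<Otimes>\<^sub>M \<nu>) borel snd) B = emeasure (\<mu> \<Otimes>\<^sub>M \<nu>) (space \<mu> \<times> B)"
      using B s sets.sets_into_space[OF B]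
      by (subst emeasure_distr) (auto simp: space_pair_measure measurable_snd'' cong: measurable_cong_sets
          intro!: arg_cong[where f="emeasure (\<mu> \<Otimes>\<^sub>M \<nu>)"])
    also have "\<dots> = emeasure \<nu> B"
      using B by (simp add: N.emeasure_pair_measure_Times M.emeasure_space_1)
    finally show "emeasure (distr (\<mu> \<Otimes>\<^sub>M \<nu>) borel snd) B = emeasure \<nu> B" .
  qed (simp add: s)
qed

lemma std_gaussian_marginals:
  "distr (std_gaussian :: ('a::euclidean_space \<times> 'b::euclidean_space) measure) borel fst = std_gaussian"
  "distr (std_gaussian :: ('a::euclidean_space \<times> 'b::euclidean_space) measure) borel snd = std_gaussian"
  unfolding std_gaussian_pair[symmetric]
  by (simp_all add: distr_pair_measure_marginals prob_space_std_gaussian)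

text \<open>A Gaussian law is determined by its mean and its covariance, even when the driving noises
  live in spaces of different dimensions.\<close>

lemma distr_std_gaussian_covariance_unique:
  fixes L :: "'b::euclidean_space \<Rightarrow> 'a::euclidean_space" and M :: "'c::euclidean_space \<Rightarrow> 'a"
  assumes L: "linear L" and M: "linear M" and eq: "\<And>u. norm (adjoint L u) = norm (adjoint M u)"
  shows "distr std_gaussian borel (\<lambda>z. m + L z) = distr std_gaussian borel (\<lambda>z. m + M z)"
proof -
  have [measurable]: "L \<in> borel_measurable borel" "M \<in> borel_measurable borel"
    using L M by (auto intro: borel_measurable_linear)
  \<comment> \<open>Both maps are lifted to the product of their source spaces, where an orthogonal map can relate them.\<close>
  define L' where "L' p = L (fst p)" for p :: "'b \<times> 'c"
  define M' where "M' p = M (snd p)" for p :: "'b \<times> 'c"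
  have lin: "linear L'" "linear M'"
    unfolding L'_def M'_def by (auto intro!: linearI simp: linear_add[OF L] linear_add[OF M] linear_scale[OF L] linear_scale[OF M])
  have [measurable]: "L' \<in> borel_measurable borel" "M' \<in> borel_measurable borel"
    using lin by (auto intro: borel_measurable_linear)
  have "adjoint L' = (\<lambda>u. (adjoint L u, 0))" "adjoint M' = (\<lambda>u. (0, adjoint M u))"
    by (rule adjoint_unique; simp add: L'_def M'_def inner_Pair_0 adjoint_works[OF L] adjoint_works[OF M])+
  then have "distr std_gaussian borel L' = distr std_gaussian borel M'"
    using eq by (intro distr_std_gaussian_eqI lin) (simp add: norm_Pair)
  then have "distr (distr std_gaussian borel L') borel ((+) m) = distr (distr std_gaussian borel M') borel ((+) m)"
    by simp
  then have "distr std_gaussian borel (\<lambda>p :: 'b \<times> 'c. m + L (fst p)) = distr std_gaussian borel (\<lambda>p :: 'b \<times> 'c. m + M (snd p))"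
    by (simp add: distr_distr o_def L'_def M'_def)
  moreover have "distr std_gaussian borel (\<lambda>p :: 'b \<times> 'c. m + L (fst p))
      = distr (distr (std_gaussian :: ('b \<times> 'c) measure) borel fst) borel (\<lambda>z. m + L z)"
    by (subst distr_distr) (auto simp: o_def)
  moreover have "distr std_gaussian borel (\<lambda>p :: 'b \<times> 'c. m + M (snd p))
      = distr (distr (std_gaussian :: ('b \<times> 'c) measure) borel snd) borel (\<lambda>z. m + M z)"
    by (subst distr_distr) (auto simp: o_def)
  ultimately show ?thesis by (simp only: std_gaussian_marginals)
qed

section \<open>Mean and covariance\<close>

lemma nn_integral_std_gaussian_coordinate:
  fixes b :: "'a::euclidean_space"
  assumes b: "b \<in> Basis"
  shows "(\<integral>\<^sup>+z. ennreal ((z \<bullet> b)\<^sup>2) \<partial>std_gaussian) = 1"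
proof -
  let ?f = "\<lambda>c t. ennreal (std_normal_density t * (if c = b then t\<^sup>2 else 1))"
  have "(\<integral>\<^sup>+z. ennreal ((z \<bullet> b)\<^sup>2) \<partial>std_gaussian) =
      (\<integral>\<^sup>+z. ennreal (\<Prod>c\<in>Basis. std_normal_density (z \<bullet> c)) * ennreal ((z \<bullet> b)\<^sup>2) \<partial>lborel)"
    by (simp add: std_gaussian_def nn_integral_density)
  also have "\<dots> = (\<integral>\<^sup>+z. (\<Prod>c\<in>Basis. ?f c (z \<bullet> c)) \<partial>lborel)"
    using b by (intro nn_integral_cong)
      (simp add: prod_ennreal prod.distrib ennreal_mult[symmetric] prod_nonneg prod.delta)
  also have "\<dots> = (\<Prod>c\<in>Basis. \<integral>\<^sup>+t. ?f c t \<partial>lborel)"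
    by (rule nn_integral_lborel_prod) auto
  also have "\<dots> = (\<Prod>c\<in>(Basis::'a set). 1)"
  proof (rule prod.cong[OF refl])
    fix c :: 'a
    show "(\<integral>\<^sup>+t. ?f c t \<partial>lborel) = 1"
      using std_normal_moment_even[of 1]
      by (cases "c = b") (simp_all add: nn_integral_eq_integral has_bochner_integral_iff)
  qed
  finally show ?thesis by simp
qed

lemma nn_integral_std_gaussian_inner:
  fixes u :: "'a::euclidean_space"
  shows "(\<integral>\<^sup>+z. ennreal ((z \<bullet> u)\<^sup>2) \<partial>std_gaussian) = ennreal ((norm u)\<^sup>2)"
proof -
  obtain b :: 'a where b: "b \<in> Basis" using nonempty_Basis by blast
  \<comment> \<open>By equality in law, \<open>z \<bullet> u\<close> may be replaced by a multiple of a single coordinate.\<close>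
  define L where "L z = z \<bullet> u" for z
  define M where "M z = norm u * (z \<bullet> b)" for z
  have lin: "linear L" "linear M"
    by (auto intro!: linearI simp: L_def M_def inner_add_left algebra_simps)
  have [measurable]: "L \<in> borel_measurable borel" "M \<in> borel_measurable borel"
    using lin by (auto intro: borel_measurable_linear)
  have "adjoint L = (\<lambda>t. t *\<^sub>R u)" "adjoint M = (\<lambda>t. (t * norm u) *\<^sub>R b)"
    by (rule adjoint_unique; simp add: L_def M_def)+
  then have "distr std_gaussian borel L = distr std_gaussian borel M"
    using b by (intro distr_std_gaussian_eqI lin) (simp add: abs_mult)
  then have "(\<integral>\<^sup>+t. ennreal (t\<^sup>2) \<partial>distr std_gaussian borel L) = (\<integral>\<^sup>+t. ennreal (t\<^sup>2) \<partial>distr std_gaussian borel M)"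
    by simp
  then have "(\<integral>\<^sup>+z. ennreal ((L z)\<^sup>2) \<partial>std_gaussian) = (\<integral>\<^sup>+z. ennreal ((M z)\<^sup>2) \<partial>std_gaussian)"
    by (simp add: nn_integral_distr)
  also have "\<dots> = (\<integral>\<^sup>+z. ennreal ((norm u)\<^sup>2) * ennreal ((z \<bullet> b)\<^sup>2) \<partial>std_gaussian)"
    by (simp add: M_def power_mult_distrib ennreal_mult)
  also have "\<dots> = ennreal ((norm u)\<^sup>2)"
    by (subst nn_integral_cmult) (simp_all add: nn_integral_std_gaussian_coordinate[OF b])
  finally show ?thesis by (simp add: L_def)
qed

lemma abs_le_one_plus_square: "\<bar>t\<bar> \<le> 1 + (t::real)\<^sup>2"
proof -
  have "0 \<le> (\<bar>t\<bar> - 1)\<^sup>2" by simp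
  then show ?thesis by (simp add: power2_diff)
qed

lemma (in finite_measure) integrable_of_integrable_square:
  fixes f :: "'a \<Rightarrow> real"
  assumes [measurable]: "f \<in> borel_measurable M" and "integrable M (\<lambda>x. (f x)\<^sup>2)"
  shows "integrable M f"
proof (rule Bochner_Integration.integrable_bound)
  show "integrable M (\<lambda>x. 1 + (f x)\<^sup>2)" using assms by auto
  show "AE x in M. norm (f x) \<le> norm (1 + (f x)\<^sup>2)"
  proof (rule AE_I2)
    fix x show "norm (f x) \<le> norm (1 + (f x)\<^sup>2)"
      using abs_le_one_plus_square[of "f x"] by simp
  qed
qed fact

lemma std_gaussian_inner_moments:
  fixes u :: "'a::euclidean_space"
  shows "integrable std_gaussian (\<lambda>z. z \<bullet> u)" "(\<integral>z. z \<bullet> u \<partial>std_gaussian) = 0"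
    "integrable std_gaussian (\<lambda>z. (z \<bullet> u)\<^sup>2)" "(\<integral>z. (z \<bullet> u)\<^sup>2 \<partial>std_gaussian) = (norm u)\<^sup>2"
proof -
  interpret S: prob_space "std_gaussian :: 'a measure" by (rule prob_space_std_gaussian)
  show sq: "integrable std_gaussian (\<lambda>z. (z \<bullet> u)\<^sup>2)"
    by (rule integrableI_bounded) (simp_all add: nn_integral_std_gaussian_inner)
  show "(\<integral>z. (z \<bullet> u)\<^sup>2 \<partial>std_gaussian) = (norm u)\<^sup>2"
    by (simp add: integral_eq_nn_integral nn_integral_std_gaussian_inner)
  show "integrable std_gaussian (\<lambda>z. z \<bullet> u)"
    by (rule S.integrable_of_integrable_square[OF _ sq]) simp
  \<comment> \<open>The law is invariant under \<open>z \<mapsto> - z\<close>, so the mean is its own negative.\<close>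
  have "(\<integral>z. z \<bullet> u \<partial>std_gaussian) = (\<integral>z. z \<bullet> u \<partial>distr std_gaussian borel (\<lambda>z::'a. - z))"
    by (subst std_gaussian_orthogonal_transformation)
      (simp_all add: orthogonal_transformation_def linear_uminus module_hom_uminus)
  also have "\<dots> = - (\<integral>z. z \<bullet> u \<partial>std_gaussian)"
    by (subst integral_distr) auto
  finally show "(\<integral>z. z \<bullet> u \<partial>std_gaussian) = 0" by simp
qed

text \<open>The covariance enters through its quadratic form, in all directions. This holds for a Gaussian and for
  an arbitrary coupling of Gaussians alike, which is what allows their costs to be compared.\<close>

definition has_mean_cov :: "'a::euclidean_space measure \<Rightarrow> 'a \<Rightarrow> ('a \<Rightarrow> 'a) \<Rightarrow> bool" where
  "has_mean_cov \<mu> m S \<longleftrightarrow> prob_space \<mu> \<and> sets \<mu> = sets borel \<and>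
     (\<forall>u. integrable \<mu> (\<lambda>x. (x - m) \<bullet> u) \<and> (\<integral>x. (x - m) \<bullet> u \<partial>\<mu>) = 0 \<and>
          integrable \<mu> (\<lambda>x. ((x - m) \<bullet> u)\<^sup>2) \<and> (\<integral>x. ((x - m) \<bullet> u)\<^sup>2 \<partial>\<mu>) = u \<bullet> S u)"

lemma has_mean_covD:
  assumes "has_mean_cov \<mu> m S"
  shows "prob_space \<mu>" "sets \<mu> = sets borel"
    "integrable \<mu> (\<lambda>x. (x - m) \<bullet> u)" "(\<integral>x. (x - m) \<bullet> u \<partial>\<mu>) = 0"
    "integrable \<mu> (\<lambda>x. ((x - m) \<bullet> u)\<^sup>2)" "(\<integral>x. ((x - m) \<bullet> u)\<^sup>2 \<partial>\<mu>) = u \<bullet> S u"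
  using assms by (auto simp: has_mean_cov_def)

lemma affine_std_gaussian_has_mean_cov:
  fixes L :: "'b::euclidean_space \<Rightarrow> 'a::euclidean_space"
  assumes "linear L"
  shows "has_mean_cov (distr std_gaussian borel (\<lambda>z. m + L z)) m (L \<circ> adjoint L)"
proof -
  interpret S: prob_space "std_gaussian :: 'b measure" by (rule prob_space_std_gaussian)
  have [measurable]: "L \<in> borel_measurable borel" using assms by (rule borel_measurable_linear)
  have L: "L z \<bullet> u = z \<bullet> adjoint L u" for z u
    using adjoint_works[OF assms] by simp
  show ?thesis
    unfolding has_mean_cov_def
    by (auto intro!: S.prob_space_distr simp: integrable_distr_eq integral_distr L std_gaussian_inner_moments)
      (simp add: dot_square_norm[symmetric] L[symmetric] inner_commute)
qed

lemma is_gaussian_has_mean_cov: "is_gaussian \<mu> m S \<Longrightarrow> has_mean_cov \<mu> m S"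
  using affine_std_gaussian_has_mean_cov unfolding is_gaussian_def by blast

text \<open>Expanding around the mean \<open>m\<close>, the cross term integrates to zero.\<close>

lemma has_mean_cov_second_moment:
  assumes "has_mean_cov \<mu> m S"
  shows "(\<integral>\<^sup>+x. ennreal (((x - c) \<bullet> u)\<^sup>2) \<partial>\<mu>) = ennreal (((m - c) \<bullet> u)\<^sup>2 + u \<bullet> S u)"
    and "0 \<le> u \<bullet> S u"
proof -
  note D = has_mean_covD[OF assms]
  interpret prob_space \<mu> by (rule D)
  define a where "a = (m - c) \<bullet> u"
  have eq: "((x - c) \<bullet> u)\<^sup>2 = a\<^sup>2 + 2 * a * ((x - m) \<bullet> u) + ((x - m) \<bullet> u)\<^sup>2" for x
    by (simp add: a_def power2_eq_square inner_diff_left algebra_simps)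
  have "(\<integral>x. a\<^sup>2 + 2 * a * ((x - m) \<bullet> u) + ((x - m) \<bullet> u)\<^sup>2 \<partial>\<mu>) = a\<^sup>2 + u \<bullet> S u"
    using D by (simp add: prob_space)
  moreover have "integrable \<mu> (\<lambda>x. a\<^sup>2 + 2 * a * ((x - m) \<bullet> u) + ((x - m) \<bullet> u)\<^sup>2)"
    using D by (auto intro!: Bochner_Integration.integrable_add)
  ultimately show "(\<integral>\<^sup>+x. ennreal (((x - c) \<bullet> u)\<^sup>2) \<partial>\<mu>) = ennreal (a\<^sup>2 + u \<bullet> S u)"
    unfolding eq by (subst nn_integral_eq_integral) (auto simp flip: eq)
  show "0 \<le> u \<bullet> S u" unfolding D(6)[symmetric] by simp
qed

lemma has_mean_cov_nn_integral_dist: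
  fixes m :: "'a::euclidean_space"
  assumes "has_mean_cov \<mu> m S"
  shows "(\<integral>\<^sup>+x. ennreal ((norm (x - c))\<^sup>2) \<partial>\<mu>) = ennreal ((norm (m - c))\<^sup>2 + (\<Sum>b\<in>Basis. b \<bullet> S b))"
proof -
  have [measurable_cong]: "sets \<mu> = sets borel" using assms by (rule has_mean_covD)
  have "(\<integral>\<^sup>+x. ennreal ((norm (x - c))\<^sup>2) \<partial>\<mu>) = (\<Sum>b\<in>Basis. \<integral>\<^sup>+x. ennreal (((x - c) \<bullet> b)\<^sup>2) \<partial>\<mu>)"
    by (subst nn_integral_sum[symmetric]) (auto simp: norm_square_eq_sum_Basis sum_ennreal)
  also have "\<dots> = ennreal (\<Sum>b\<in>Basis. ((m - c) \<bullet> b)\<^sup>2 + b \<bullet> S b)"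
    using has_mean_cov_second_moment[OF assms] by (simp add: sum_ennreal flip: ennreal_plus)
  finally show ?thesis by (simp add: sum.distrib norm_square_eq_sum_Basis)
qed

text \<open>The two variables are independent. With equal laws this becomes twice the trace of the covariance,
  the source of the factor two under the square roots of the upper bound.\<close>

lemma has_mean_cov_nn_integral_independent:
  fixes m :: "'a::euclidean_space"
  assumes "has_mean_cov \<mu> m S" and "has_mean_cov \<nu> m' S'"
  shows "(\<integral>\<^sup>+y. \<integral>\<^sup>+x. ennreal ((norm (x - y))\<^sup>2) \<partial>\<mu> \<partial>\<nu>)
      = ennreal ((norm (m - m'))\<^sup>2 + (\<Sum>b\<in>Basis. b \<bullet> S b) + (\<Sum>b\<in>Basis. b \<bullet> S' b))"
proof -
  interpret N: prob_space \<nu> using assms(2) by (rule has_mean_covD)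
  have [measurable_cong]: "sets \<nu> = sets borel" using assms(2) by (rule has_mean_covD)
  have nn: "0 \<le> (\<Sum>b\<in>Basis. b \<bullet> S b)" "0 \<le> (\<Sum>b\<in>Basis. b \<bullet> S' b)"
    using has_mean_cov_second_moment(2) assms by (blast intro: sum_nonneg)+
  then have "(\<integral>\<^sup>+y. \<integral>\<^sup>+x. ennreal ((norm (x - y))\<^sup>2) \<partial>\<mu> \<partial>\<nu>)
      = (\<integral>\<^sup>+y. ennreal ((norm (y - m))\<^sup>2) + ennreal (\<Sum>b\<in>Basis. b \<bullet> S b) \<partial>\<nu>)"
    unfolding has_mean_cov_nn_integral_dist[OF assms(1)] by (simp add: norm_minus_commute ennreal_plus)
  also have "\<dots> = ennreal ((norm (m' - m))\<^sup>2 + (\<Sum>b\<in>Basis. b \<bullet> S' b)) + ennreal (\<Sum>b\<in>Basis. b \<bullet> S b)"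
    by (simp add: nn_integral_add has_mean_cov_nn_integral_dist[OF assms(2)] N.emeasure_space_1)
  also have "\<dots> = ennreal ((norm (m' - m))\<^sup>2 + (\<Sum>b\<in>Basis. b \<bullet> S' b) + (\<Sum>b\<in>Basis. b \<bullet> S b))"
    using nn by (simp add: ennreal_plus)
  finally show ?thesis by (simp add: norm_minus_commute algebra_simps)
qed

lemma is_gaussianE:
  fixes \<mu> :: "'a::euclidean_space measure"
  assumes "is_gaussian \<mu> m S"
  obtains A :: "'a \<Rightarrow> 'a" where "linear A" "S = A \<circ> adjoint A" "\<mu> = distr std_gaussian borel (\<lambda>z. m + A z)"
proof -
  have "\<exists>A :: 'a \<Rightarrow> 'a. linear A \<and> S = A \<circ> adjoint A \<and> \<mu> = distr std_gaussian borel (\<lambda>z. m + A z)"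
    using assms by (simp only: is_gaussian_def)
  then show thesis
  proof (rule exE)
    fix A :: "'a \<Rightarrow> 'a"
    assume A: "linear A \<and> S = A \<circ> adjoint A \<and> \<mu> = distr std_gaussian borel (\<lambda>z. m + A z)"
    show thesis
      by (rule that[OF A[THEN conjunct1] A[THEN conjunct2, THEN conjunct1] A[THEN conjunct2, THEN conjunct2]])
  qed
qed

lemma is_gaussianI:
  fixes A :: "'a::euclidean_space \<Rightarrow> 'a"
  assumes "linear A"
  shows "is_gaussian (distr std_gaussian borel (\<lambda>z. m + A z)) m (A \<circ> adjoint A)"
  using assms by (auto simp only: is_gaussian_def)

lemma is_gaussian_pair_measure:
  fixes \<mu> \<nu> :: "'a::euclidean_space measure"
  assumes "is_gaussian \<mu> m S" "is_gaussian \<nu> m' S'"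
  shows "\<exists>m S. is_gaussian (\<mu> \<Otimes>\<^sub>M \<nu>) m S"
proof -
  obtain A :: "'a \<Rightarrow> 'a" where A: "linear A" "S = A \<circ> adjoint A" "\<mu> = distr std_gaussian borel (\<lambda>z. m + A z)"
    using assms(1) by (rule is_gaussianE)
  obtain B :: "'a \<Rightarrow> 'a" where B: "linear B" "S' = B \<circ> adjoint B" "\<nu> = distr std_gaussian borel (\<lambda>z. m' + B z)"
    using assms(2) by (rule is_gaussianE)
  have [measurable]: "A \<in> borel_measurable borel" "B \<in> borel_measurable borel"
    using A(1) B(1) by (auto intro: borel_measurable_linear)
  interpret S: prob_space "std_gaussian :: 'a measure" by (rule prob_space_std_gaussian)
  interpret B: prob_space \<nu> unfolding B(3) by (rule S.prob_space_distr) simp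
  define C where "C = (\<lambda>p. (A (fst p), B (snd p)))"
  have C: "linear C"
    by (rule linearI) (simp_all add: C_def linear_add linear_scale A(1) B(1))
  have "\<mu> \<Otimes>\<^sub>M \<nu> = distr (std_gaussian \<Otimes>\<^sub>M std_gaussian) (borel \<Otimes>\<^sub>M borel) (\<lambda>(x, y). (m + A x, m' + B y))"
    unfolding A(3) B(3)
    by (rule pair_measure_distr) (auto simp: B.sigma_finite_measure simp flip: B(3))
  also have "\<dots> = distr std_gaussian borel (\<lambda>z. (m, m') + C z)"
    by (simp add: std_gaussian_pair borel_prod C_def case_prod_beta')
  finally show ?thesis using is_gaussianI[OF C, of "(m, m')"] by auto
qed

lemma gaussian_eq_of_second_moments:
  fixes \<mu> :: "'a::euclidean_space measure" and L :: "'b::euclidean_space \<Rightarrow> 'a"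
  assumes \<mu>: "is_gaussian \<mu> m S" and L: "linear L"
    and eq: "\<And>u. (\<integral>x. ((x - m) \<bullet> u)\<^sup>2 \<partial>distr std_gaussian borel (\<lambda>z. m + L z)) = (\<integral>x. ((x - m) \<bullet> u)\<^sup>2 \<partial>\<mu>)"
  shows "distr std_gaussian borel (\<lambda>z. m + L z) = \<mu>"
proof -
  obtain A :: "'a \<Rightarrow> 'a" where A: "linear A" "S = A \<circ> adjoint A" "\<mu> = distr std_gaussian borel (\<lambda>z. m + A z)"
    using \<mu> by (rule is_gaussianE)
  have "norm (adjoint L u) = norm (adjoint A u)" for u
  proof -
    have "(norm (adjoint L u))\<^sup>2 = u \<bullet> (L \<circ> adjoint L) u"
      by (simp add: dot_square_norm[symmetric] adjoint_works[OF L] inner_commute)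
    also have "\<dots> = (\<integral>x. ((x - m) \<bullet> u)\<^sup>2 \<partial>distr std_gaussian borel (\<lambda>z. m + L z))"
      by (rule has_mean_covD(6)[OF affine_std_gaussian_has_mean_cov[OF L], symmetric])
    also have "\<dots> = (\<integral>x. ((x - m) \<bullet> u)\<^sup>2 \<partial>distr std_gaussian borel (\<lambda>z. m + A z))"
      unfolding eq A(3) ..
    also have "\<dots> = u \<bullet> (A \<circ> adjoint A) u"
      by (rule has_mean_covD(6)[OF affine_std_gaussian_has_mean_cov[OF A(1)]])
    also have "\<dots> = (norm (adjoint A u))\<^sup>2"
      by (simp add: dot_square_norm[symmetric] adjoint_works[OF A(1)] inner_commute)
    finally show ?thesis by simp
  qed
  then show ?thesis unfolding A(3) by (rule distr_std_gaussian_covariance_unique[OF L A(1)])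
qed

section \<open>Finite mixtures\<close>

text \<open>Weights in \<open>ennreal\<close> and an arbitrary finite index set: products of index sets and supports of discrete
  measures then serve directly as labels, without an enumeration.\<close>

definition mixture_of ::
  "'a::topological_space measure \<Rightarrow> 'i set \<Rightarrow> ('i \<Rightarrow> ennreal) \<Rightarrow> ('i \<Rightarrow> 'a measure) \<Rightarrow> bool" where
  "mixture_of \<mu> I c \<nu> \<longleftrightarrow> finite I \<and> sets \<mu> = sets borel \<and> (\<forall>i\<in>I. sets (\<nu> i) = sets borel) \<and>
     (\<forall>B\<in>sets borel. emeasure \<mu> B = (\<Sum>i\<in>I. c i * emeasure (\<nu> i) B))"

lemma mixture_ofD:
  assumes "mixture_of \<mu> I c \<nu>"
  shows "finite I" "sets \<mu> = sets borel" "space \<mu> = UNIV"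
    "\<And>i. i \<in> I \<Longrightarrow> sets (\<nu> i) = sets borel" "\<And>i. i \<in> I \<Longrightarrow> space (\<nu> i) = UNIV"
    "\<And>B. B \<in> sets borel \<Longrightarrow> emeasure \<mu> B = (\<Sum>i\<in>I. c i * emeasure (\<nu> i) B)"
  using assms sets_eq_imp_space_eq[of _ borel] by (auto simp: mixture_of_def)

lemma mixture_of_exists:
  fixes \<nu> :: "'i \<Rightarrow> 'a::topological_space measure"
  assumes "finite I" and sets: "\<And>i. i \<in> I \<Longrightarrow> sets (\<nu> i) = sets borel"
  shows "\<exists>\<mu>. mixture_of \<mu> I c \<nu>"
proof -
  let ?f = "\<lambda>B. \<Sum>i\<in>I. c i * emeasure (\<nu> i) B"
  let ?M = "measure_of UNIV (sets borel) ?f"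
  have sa: "sigma_algebra UNIV (sets (borel :: 'a measure))"
    using sets.sigma_algebra_axioms[of "borel :: 'a measure"] by simp
  have sM: "sets ?M = sets borel"
    using sigma_algebra.sets_measure_of_eq[OF sa] by simp
  have "emeasure ?M B = ?f B" if B: "B \<in> sets borel" for B
  proof (rule emeasure_measure_of_sigma[OF sa _ _ B])
    show "positive (sets borel) ?f" by (auto simp: positive_def)
    show "countably_additive (sets borel) ?f"
      unfolding countably_additive_def
    proof (intro allI impI)
      fix A :: "nat \<Rightarrow> 'a set"
      assume A: "range A \<subseteq> sets borel" "disjoint_family A" "\<Union> (range A) \<in> sets borel"
      have "(\<Sum>n. ?f (A n)) = (\<Sum>i\<in>I. \<Sum>n. c i * emeasure (\<nu> i) (A n))"
        by (rule suminf_sum) simp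
      also have "\<dots> = ?f (\<Union> (range A))"
        using A sets by (intro sum.cong refl) (simp add: suminf_emeasure)
      finally show "(\<Sum>n. ?f (A n)) = ?f (\<Union> (range A))" .
    qed
  qed
  then have "mixture_of ?M I c \<nu>" using assms sM by (simp add: mixture_of_def)
  then show ?thesis ..
qed

lemma nn_integral_mixture_of:
  fixes f :: "'a::topological_space \<Rightarrow> ennreal"
  assumes mix: "mixture_of \<mu> I c \<nu>" and "f \<in> borel_measurable borel"
  shows "(\<integral>\<^sup>+x. f x \<partial>\<mu>) = (\<Sum>i\<in>I. c i * (\<integral>\<^sup>+x. f x \<partial>\<nu> i))"
proof -
  note D = mixture_ofD[OF mix]
  have [measurable_cong]: "sets \<mu> = sets borel" by (rule D)
  have m: "g \<in> borel_measurable (\<nu> i)" if "i \<in> I" "g \<in> borel_measurable borel"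
    for i and g :: "'a \<Rightarrow> ennreal"
    using that D(4)[OF that(1)] by (simp cong: measurable_cong_sets)
  from assms(2) show ?thesis
  proof (induction rule: borel_measurable_induct)
    case (cong f g)
    then show ?case by (simp add: fun_eq_iff[symmetric])
  next
    case (set A)
    then show ?case using D by (simp cong: sum.cong)
  next
    case (mult u a)
    then show ?case using m by (simp add: nn_integral_cmult sum_distrib_left mult_ac)
  next
    case (add u v)
    then show ?case using m by (simp add: nn_integral_add sum.distrib distrib_left)
  next
    case (seq U)
    have "(\<integral>\<^sup>+x. (SUP n. U n x) \<partial>\<mu>) = (SUP n. \<Sum>i\<in>I. c i * (\<integral>\<^sup>+x. U n x \<partial>\<nu> i))"
      using seq by (simp add: nn_integral_monotone_convergence_SUP image_comp)
    also have "\<dots> = (\<Sum>i\<in>I. SUP n. c i * (\<integral>\<^sup>+x. U n x \<partial>\<nu> i))"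
    proof (rule ennreal_SUP_sum)
      fix i assume "i \<in> I"
      show "incseq (\<lambda>n. c i * (\<integral>\<^sup>+x. U n x \<partial>\<nu> i))"
      proof (rule incseq_SucI)
        fix n
        have "U n x \<le> U (Suc n) x" for x
          using incseq_SucD[OF \<open>incseq U\<close>, of n] by (simp only: le_fun_def)
        then show "c i * (\<integral>\<^sup>+x. U n x \<partial>\<nu> i) \<le> c i * (\<integral>\<^sup>+x. U (Suc n) x \<partial>\<nu> i)"
          by (intro mult_left_mono nn_integral_mono) simp_all
      qed
    qed
    also have "\<dots> = (\<Sum>i\<in>I. c i * (\<integral>\<^sup>+x. (SUP n. U n x) \<partial>\<nu> i))"
    proof (rule sum.cong[OF refl])
      fix i assume i: "i \<in> I"
      have "(\<integral>\<^sup>+x. (SUP n. U n x) \<partial>\<nu> i) = (SUP n. \<integral>\<^sup>+x. U n x \<partial>\<nu> i)"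
        by (rule nn_integral_monotone_convergence_SUP[OF \<open>incseq U\<close> m[OF i seq(1)]])
      then show "(SUP n. c i * (\<integral>\<^sup>+x. U n x \<partial>\<nu> i)) = c i * (\<integral>\<^sup>+x. (SUP n. U n x) \<partial>\<nu> i)"
        by (simp only: SUP_mult_left_ennreal)
    qed
    finally show ?case by (simp only: SUP_apply)
  qed
qed

lemma mixture_of_distr:
  assumes mix: "mixture_of \<mu> I c \<nu>" and T: "T \<in> borel_measurable borel"
  shows "mixture_of (distr \<mu> borel T) I c (\<lambda>i. distr (\<nu> i) borel T)"
proof -
  note D = mixture_ofD[OF mix]
  have "emeasure (distr \<mu> borel T) B = (\<Sum>i\<in>I. c i * emeasure (distr (\<nu> i) borel T) B)"
    if B: "B \<in> sets borel" for B
  proof -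
    have "T \<in> measurable \<mu> borel" "\<And>i. i \<in> I \<Longrightarrow> T \<in> measurable (\<nu> i) borel"
      using T D by (simp_all cong: measurable_cong_sets)
    moreover have "T -` B \<in> sets borel" using measurable_sets[OF T B] by simp
    ultimately show ?thesis using B D by (simp add: emeasure_distr)
  qed
  then show ?thesis using D by (simp add: mixture_of_def)
qed

lemma prob_space_mixture_of:
  assumes mix: "mixture_of \<mu> I c \<nu>" and "(\<Sum>i\<in>I. c i) = 1" "\<And>i. i \<in> I \<Longrightarrow> prob_space (\<nu> i)"
  shows "prob_space \<mu>"
proof
  note D = mixture_ofD[OF mix]
  have "emeasure (\<nu> i) UNIV = 1" if "i \<in> I" for i
    using prob_space.emeasure_space_1[OF assms(3)] D(5) that by metis
  then show "emeasure \<mu> (space \<mu>) = 1"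
    using D(3) D(6)[of UNIV] assms(2) by simp
qed

text \<open>The one place where the index set is enumerated, as the definition of a Gaussian mixture demands.\<close>

lemma GMM_finI:
  fixes \<mu> :: "'a::euclidean_space measure"
  assumes mix: "mixture_of \<mu> I c \<nu>" and c: "(\<Sum>i\<in>I. c i) = 1"
    and g: "\<And>i. i \<in> I \<Longrightarrow> \<exists>m S. is_gaussian (\<nu> i) m S"
  shows "\<mu> \<in> GMM_fin"
proof -
  note D = mixture_ofD[OF mix]
  obtain h where h: "bij_betw h {..<card I} I"
    using ex_bij_betw_nat_finite[OF D(1)] by (auto simp: atLeast0LessThan)
  have hI: "h k \<in> I" if "k < card I" for k
    using h that by (auto simp: bij_betw_def)
  obtain m S where mS: "\<And>i. i \<in> I \<Longrightarrow> is_gaussian (\<nu> i) (m i) (S i)" using g by metis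
  have fin: "c i < top" if "i \<in> I" for i
    using member_le_sum[OF that _ D(1), of c] c le_less_trans[OF _ ennreal_one_less_top, of "c i"] by simp
  have "is_gaussian_mixture \<mu> (card I) (\<lambda>k. enn2real (c (h k))) (m \<circ> h) (S \<circ> h)"
    unfolding is_gaussian_mixture_def
  proof (intro conjI exI[of _ "\<nu> \<circ> h"] ballI allI impI)
    show "sets \<mu> = sets borel" by (rule D)
    have "ennreal (\<Sum>k<card I. enn2real (c (h k))) = (\<Sum>k<card I. c (h k))"
      using fin hI by (simp add: sum_ennreal[symmetric])
    also have "\<dots> = 1" using sum.reindex_bij_betw[OF h, of c] c by simp
    finally show "(\<Sum>k<card I. enn2real (c (h k))) = 1" by simp
    fix B :: "'a set" assume "B \<in> sets borel"
    then show "emeasure \<mu> B = (\<Sum>k<card I. ennreal (enn2real (c (h k))) * emeasure ((\<nu> \<circ> h) k) B)"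
      using fin hI D(6)[of B] sum.reindex_bij_betw[OF h, of "\<lambda>i. c i * emeasure (\<nu> i) B"] by simp
  qed (use mS hI in auto)
  then show ?thesis by (auto simp: GMM_fin_def GMM_def)
qed

lemma is_gaussian_mixture_mixture_of:
  fixes \<mu> :: "'a::euclidean_space measure"
  assumes "is_gaussian_mixture \<mu> K \<pi> m S"
  obtains \<nu> where "mixture_of \<mu> {..<K} (\<lambda>k. ennreal (\<pi> k)) \<nu>" "(\<Sum>k<K. ennreal (\<pi> k)) = 1"
    "\<And>k. k < K \<Longrightarrow> 0 \<le> \<pi> k" "\<And>k. k < K \<Longrightarrow> is_gaussian (\<nu> k) (m k) (S k)"
proof -
  obtain \<nu> where \<nu>: "\<And>k. k < K \<Longrightarrow> is_gaussian (\<nu> k) (m k) (S k)"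
    "\<And>B. B\<in>sets borel \<Longrightarrow> emeasure \<mu> B = (\<Sum>k<K. ennreal (\<pi> k) * emeasure (\<nu> k) B)"
    and pi: "\<And>k. k < K \<Longrightarrow> 0 \<le> \<pi> k" "(\<Sum>k<K. \<pi> k) = 1" and s: "sets \<mu> = sets borel"
    using assms unfolding is_gaussian_mixture_def by blast
  have "sets (\<nu> k) = sets borel" if "k < K" for k
    using \<nu>(1)[OF that] by (auto simp: is_gaussian_def)
  then have "mixture_of \<mu> {..<K} (\<lambda>k. ennreal (\<pi> k)) \<nu>"
    using \<nu> s by (simp add: mixture_of_def)
  moreover have "(\<Sum>k<K. ennreal (\<pi> k)) = 1" using pi by (subst sum_ennreal) auto
  ultimately show ?thesis using that pi \<nu> by blast
qed

lemma GMM_finE: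
  fixes \<mu> :: "'a::euclidean_space measure"
  assumes "\<mu> \<in> GMM_fin"
  obtains K and c and \<nu> where "mixture_of \<mu> {..<K::nat} c \<nu>" "(\<Sum>k<K. c k) = 1"
    "\<And>k. k < K \<Longrightarrow> \<exists>m S. is_gaussian (\<nu> k) m S"
proof -
  obtain K \<pi> m S where "is_gaussian_mixture \<mu> K \<pi> m S"
    using assms by (auto simp: GMM_fin_def GMM_def)
  then obtain \<nu> where \<nu>: "mixture_of \<mu> {..<K} (\<lambda>k. ennreal (\<pi> k)) \<nu>" "(\<Sum>k<K. ennreal (\<pi> k)) = 1"
    "\<And>k. k < K \<Longrightarrow> 0 \<le> \<pi> k" "\<And>k. k < K \<Longrightarrow> is_gaussian (\<nu> k) (m k) (S k)"
    using is_gaussian_mixture_mixture_of by metis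
  show ?thesis by (rule that[OF \<nu>(1,2)]) (use \<nu>(4) in blast)
qed

lemma GMM_fin_prob_space: "\<mu> \<in> GMM_fin \<Longrightarrow> prob_space \<mu>"
  by (erule GMM_finE, erule prob_space_mixture_of)
    (auto dest: is_gaussian_has_mean_cov has_mean_covD(1))

lemma GMM_fin_sets: "\<mu> \<in> GMM_fin \<Longrightarrow> sets \<mu> = sets borel"
  by (erule GMM_finE, erule mixture_ofD)

lemma GMM_fin_second_moment:
  fixes \<mu> :: "'a::euclidean_space measure"
  assumes "\<mu> \<in> GMM_fin"
  shows "(\<integral>\<^sup>+x. ennreal ((norm x)\<^sup>2) \<partial>\<mu>) < \<infinity>"
  using assms
proof (rule GMM_finE)
  fix K :: nat and c \<nu>
  assume mix: "mixture_of \<mu> {..<K} c \<nu>" and c: "(\<Sum>k<K. c k) = 1"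
    and g: "\<And>k. k < K \<Longrightarrow> \<exists>m S. is_gaussian (\<nu> k) m S"
  have "c k * (\<integral>\<^sup>+x. ennreal ((norm x)\<^sup>2) \<partial>\<nu> k) < \<infinity>" if "k < K" for k
  proof -
    obtain m S where "is_gaussian (\<nu> k) m S" using g \<open>k < K\<close> by blast
    then have "(\<integral>\<^sup>+x. ennreal ((norm x)\<^sup>2) \<partial>\<nu> k) < \<infinity>"
      using has_mean_cov_nn_integral_dist[OF is_gaussian_has_mean_cov, of "\<nu> k" m S 0] by simp
    moreover have "c k \<le> 1"
      using c member_le_sum[of k "{..<K}" c] that by simp
    then have "c k < \<infinity>" using le_less_trans[OF _ ennreal_one_less_top, of "c k"] by simp
    ultimately show ?thesis by (simp add: ennreal_mult_less_top)
  qed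
  moreover have "(\<integral>\<^sup>+x. ennreal ((norm x)\<^sup>2) \<partial>\<mu>) = (\<Sum>k<K. c k * (\<integral>\<^sup>+x. ennreal ((norm x)\<^sup>2) \<partial>\<nu> k))"
    by (rule nn_integral_mixture_of[OF mix]) simp
  ultimately show ?thesis by simp
qed

text \<open>The functions \<open>f i\<close> are the posterior probabilities of the labels given the point. They are
  Radon--Nikodym derivatives, since degenerate components have no Lebesgue density.\<close>

lemma mixture_densities:
  fixes \<mu> :: "'a::topological_space measure"
  assumes mix: "mixture_of \<mu> I c \<nu>" and \<mu>: "prob_space \<mu>"
  obtains f where "\<And>i. i \<in> I \<Longrightarrow> f i \<in> borel_measurable borel"
    "\<And>i h. i \<in> I \<Longrightarrow> h \<in> borel_measurable borel \<Longrightarrow> (\<integral>\<^sup>+x. f i x * h x \<partial>\<mu>) = c i * (\<integral>\<^sup>+x. h x \<partial>\<nu> i)"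
    "AE x in \<mu>. (\<Sum>i\<in>I. f i x) = 1"
proof -
  interpret prob_space \<mu> by fact
  note D = mixture_ofD[OF mix]
  \<comment> \<open>Each weighted component is dominated by the mixture.\<close>
  have "\<exists>f\<in>borel_measurable \<mu>. density \<mu> f = scale_measure (c i) (\<nu> i)" if i: "i \<in> I" for i
  proof (rule Radon_Nikodym)
    show "sets (scale_measure (c i) (\<nu> i)) = sets \<mu>" using D i by simp
    have "c i * emeasure (\<nu> i) B \<le> emeasure \<mu> B" if "B \<in> sets borel" for B
      unfolding D(6)[OF that] by (rule member_le_sum[OF i]) (auto simp: D)
    then show "absolutely_continuous \<mu> (scale_measure (c i) (\<nu> i))"
      using D i by (force simp: absolutely_continuous_def null_sets_def)
  qed
  then obtain f where f: "\<And>i. i \<in> I \<Longrightarrow> f i \<in> borel_measurable \<mu>"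
      "\<And>i. i \<in> I \<Longrightarrow> density \<mu> (f i) = scale_measure (c i) (\<nu> i)"
    by metis
  have bm: "borel_measurable \<mu> = borel_measurable borel"
    using D(2) by (intro measurable_cong_sets) auto
  show ?thesis
  proof (rule that)
    show "f i \<in> borel_measurable borel" if "i \<in> I" for i using f(1)[OF that] by (simp add: bm)
    show "(\<integral>\<^sup>+x. f i x * h x \<partial>\<mu>) = c i * (\<integral>\<^sup>+x. h x \<partial>\<nu> i)"
      if i: "i \<in> I" and h: "h \<in> borel_measurable borel" for i and h :: "'a \<Rightarrow> ennreal"
    proof -
      have "(\<integral>\<^sup>+x. f i x * h x \<partial>\<mu>) = (\<integral>\<^sup>+x. h x \<partial>density \<mu> (f i))"
        using f(1)[OF i] h by (subst nn_integral_density) (auto simp: bm)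
      also have "\<dots> = c i * (\<integral>\<^sup>+x. h x \<partial>\<nu> i)"
        unfolding f(2)[OF i] using h D(4)[OF i]
        by (intro nn_integral_scale_measure) (simp cong: measurable_cong_sets)
      finally show ?thesis .
    qed
    have "density \<mu> (\<lambda>x. \<Sum>i\<in>I. f i x) = density \<mu> (\<lambda>x. 1)"
    proof (rule measure_eqI)
      fix B assume "B \<in> sets (density \<mu> (\<lambda>x. \<Sum>i\<in>I. f i x))"
      then have B: "B \<in> sets \<mu>" by simp
      have "emeasure (density \<mu> (\<lambda>x. \<Sum>i\<in>I. f i x)) B = (\<Sum>i\<in>I. emeasure (density \<mu> (f i)) B)"
        using f(1) B by (simp add: emeasure_density sum_distrib_right nn_integral_sum)
      also have "\<dots> = emeasure \<mu> B" using B D by (simp add: f(2))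
      finally show "emeasure (density \<mu> (\<lambda>x. \<Sum>i\<in>I. f i x)) B = emeasure (density \<mu> (\<lambda>x. 1)) B"
        by (simp add: density_1)
    qed simp
    then show "AE x in \<mu>. (\<Sum>i\<in>I. f i x) = 1"
      using f(1) by (subst (asm) density_unique_iff) auto
  qed
qed

section \<open>Couplings and their cost\<close>

lemma coupling_cost_finite:
  fixes \<mu>0 \<mu>1 :: "'a::euclidean_space measure"
  assumes \<gamma>: "\<gamma> \<in> couplings \<mu>0 \<mu>1" and fin: "(\<integral>\<^sup>+x. ennreal ((norm x)\<^sup>2) \<partial>\<mu>0) < \<infinity>" "(\<integral>\<^sup>+x. ennreal ((norm x)\<^sup>2) \<partial>\<mu>1) < \<infinity>"
  shows "transport_cost \<gamma> < \<infinity>"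
proof -
  have s: "sets \<gamma> = sets borel" and eq: "distr \<gamma> borel fst = \<mu>0" "distr \<gamma> borel snd = \<mu>1"
    using \<gamma> by (auto simp: couplings_def)
  note [measurable_cong] = s
  have m: "fst \<in> measurable \<gamma> borel" "snd \<in> measurable \<gamma> borel" by simp_all
  have "transport_cost \<gamma> \<le> (\<integral>\<^sup>+y. 2 * ennreal ((norm (fst y))\<^sup>2) + 2 * ennreal ((norm (snd y))\<^sup>2) \<partial>\<gamma>)"
    unfolding transport_cost_def
  proof (rule nn_integral_mono)
    fix y :: "'a \<times> 'a"
    have "norm (fst y - snd y) \<le> norm (fst y) + norm (snd y)" by (rule norm_triangle_ineq4)
    then have "(norm (fst y - snd y))\<^sup>2 \<le> (norm (fst y) + norm (snd y))\<^sup>2" by (simp add: power_mono)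
    also have "\<dots> \<le> 2 * (norm (fst y))\<^sup>2 + 2 * (norm (snd y))\<^sup>2"
      using sum_squares_bound[of "norm (fst y)" "norm (snd y)"] by (simp add: power2_sum)
    finally have "ennreal ((norm (fst y - snd y))\<^sup>2) \<le> ennreal (2 * (norm (fst y))\<^sup>2 + 2 * (norm (snd y))\<^sup>2)"
      by (rule ennreal_leI)
    then show "ennreal ((norm (fst y - snd y))\<^sup>2) \<le> 2 * ennreal ((norm (fst y))\<^sup>2) + 2 * ennreal ((norm (snd y))\<^sup>2)"
      by (simp add: ennreal_plus ennreal_mult)
  qed
  also have "\<dots> = 2 * (\<integral>\<^sup>+x. ennreal ((norm x)\<^sup>2) \<partial>distr \<gamma> borel fst) + 2 * (\<integral>\<^sup>+x. ennreal ((norm x)\<^sup>2) \<partial>distr \<gamma> borel snd)"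
    using m by (subst nn_integral_add) (auto simp: nn_integral_cmult nn_integral_distr)
  also have "\<dots> < \<infinity>" using fin unfolding eq by (simp add: ennreal_mult_less_top)
  finally show ?thesis .
qed

lemma GMM_coupling_cost_finite:
  fixes \<mu>0 \<mu>1 :: "'a::euclidean_space measure"
  assumes "\<mu>0 \<in> GMM_fin" "\<mu>1 \<in> GMM_fin" "\<gamma> \<in> couplings \<mu>0 \<mu>1"
  shows "transport_cost \<gamma> < \<infinity>"
  using assms by (intro coupling_cost_finite GMM_fin_second_moment)

lemma transport_cost_product:
  fixes \<mu> \<nu> :: "'a::euclidean_space measure"
  assumes "has_mean_cov \<mu> m S" "has_mean_cov \<nu> m' S'"
  shows "transport_cost (\<mu> \<Otimes>\<^sub>M \<nu>) = (\<integral>\<^sup>+y. \<integral>\<^sup>+x. ennreal ((norm (x - y))\<^sup>2) \<partial>\<mu> \<partial>\<nu>)"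
proof -
  interpret M: prob_space \<mu> using assms(1) by (rule has_mean_covD)
  interpret N: prob_space \<nu> using assms(2) by (rule has_mean_covD)
  interpret pair_sigma_finite \<mu> \<nu> ..
  have [measurable_cong]: "sets \<mu> = sets borel" "sets \<nu> = sets borel" using assms by (auto dest: has_mean_covD)
  show ?thesis unfolding transport_cost_def
    by (subst nn_integral_snd[symmetric]) auto
qed

text \<open>A coupling \<open>w\<close> of the labels lifts to a coupling of the mixtures: draw a pair of labels from \<open>w\<close>, then
  draw the two points independently from the two components.\<close>

lemma mixture_couplings:
  fixes \<mu>0 \<mu>1 :: "'a::euclidean_space measure"
  assumes mix0: "mixture_of \<mu>0 I c0 \<nu>0" and mix1: "mixture_of \<mu>1 J c1 \<nu>1"
    and p0: "\<And>i. i \<in> I \<Longrightarrow> prob_space (\<nu>0 i)" and p1: "\<And>j. j \<in> J \<Longrightarrow> prob_space (\<nu>1 j)"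
    and w0: "\<And>i. i \<in> I \<Longrightarrow> (\<Sum>j\<in>J. w i j) = c0 i" and w1: "\<And>j. j \<in> J \<Longrightarrow> (\<Sum>i\<in>I. w i j) = c1 j"
    and c: "(\<Sum>i\<in>I. c0 i) = 1"
    and mix: "mixture_of \<gamma> (I \<times> J) (\<lambda>(i, j). w i j) (\<lambda>(i, j). \<nu>0 i \<Otimes>\<^sub>M \<nu>1 j)"
  shows "\<gamma> \<in> couplings \<mu>0 \<mu>1"
proof -
  note D0 = mixture_ofD[OF mix0] and D1 = mixture_ofD[OF mix1] and D = mixture_ofD[OF mix]
  have w: "(\<Sum>(i, j)\<in>I \<times> J. w i j) = 1"
    using w0 c by (simp add: sum.cartesian_product[symmetric])
  have pp: "prob_space (\<nu>0 i \<Otimes>\<^sub>M \<nu>1 j)" if "i \<in> I" "j \<in> J" for i j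
    using p0[OF that(1)] p1[OF that(2)] by (intro prob_space_pair)
  have "prob_space \<gamma>"
    using mix w pp by (intro prob_space_mixture_of[OF mix]) (auto simp: case_prod_beta)
  have e: "emeasure (\<nu>0 i \<Otimes>\<^sub>M \<nu>1 j) (A \<times> B) = emeasure (\<nu>0 i) A * emeasure (\<nu>1 j) B"
    if "i \<in> I" "j \<in> J" "A \<in> sets borel" "B \<in> sets borel" for i j A B
  proof -
    interpret prob_space "\<nu>1 j" using p1 that by simp
    show ?thesis using that D0 D1 by (intro emeasure_pair_measure_Times) auto
  qed
  have u: "emeasure (\<nu>0 i) UNIV = 1" "emeasure (\<nu>1 j) UNIV = 1" if "i \<in> I" "j \<in> J" for i j
    using prob_space.emeasure_space_1[OF p0[OF that(1)]] prob_space.emeasure_space_1[OF p1[OF that(2)]]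
      D0(5)[OF that(1)] D1(5)[OF that(2)] by simp_all
  have meas: "fst \<in> measurable \<gamma> borel" "snd \<in> measurable \<gamma> borel"
    using D(2) by (simp_all cong: measurable_cong_sets add: borel_prod[symmetric])
  have "distr \<gamma> borel fst = \<mu>0"
  proof (rule measure_eqI)
    show "sets (distr \<gamma> borel fst) = sets \<mu>0" using D0 by simp
    fix B :: "'a set" assume "B \<in> sets (distr \<gamma> borel fst)"
    then have B: "B \<in> sets borel" by simp
    then have "emeasure (distr \<gamma> borel fst) B = emeasure \<gamma> (B \<times> UNIV)"
      using meas D(3) by (subst emeasure_distr) (auto intro!: arg_cong[where f="emeasure \<gamma>"])
    also have "\<dots> = (\<Sum>(i, j)\<in>I \<times> J. w i j * emeasure (\<nu>0 i \<Otimes>\<^sub>M \<nu>1 j) (B \<times> UNIV))"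
      using B by (subst D(6)) (auto simp: case_prod_beta borel_prod[symmetric])
    also have "\<dots> = (\<Sum>i\<in>I. \<Sum>j\<in>J. w i j * emeasure (\<nu>0 i) B)"
      unfolding sum.cartesian_product using B by (intro sum.cong refl) (auto simp: e u)
    also have "\<dots> = emeasure \<mu>0 B"
      using B D0(6)[OF B] w0 by (simp add: sum_distrib_right[symmetric])
    finally show "emeasure (distr \<gamma> borel fst) B = emeasure \<mu>0 B" .
  qed
  moreover have "distr \<gamma> borel snd = \<mu>1"
  proof (rule measure_eqI)
    show "sets (distr \<gamma> borel snd) = sets \<mu>1" using D1 by simp
    fix B :: "'a set" assume "B \<in> sets (distr \<gamma> borel snd)"
    then have B: "B \<in> sets borel" by simp
    then have "emeasure (distr \<gamma> borel snd) B = emeasure \<gamma> (UNIV \<times> B)"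
      using meas D(3) by (subst emeasure_distr) (auto intro!: arg_cong[where f="emeasure \<gamma>"])
    also have "\<dots> = (\<Sum>(i, j)\<in>I \<times> J. w i j * emeasure (\<nu>0 i \<Otimes>\<^sub>M \<nu>1 j) (UNIV \<times> B))"
      using B by (subst D(6)) (auto simp: case_prod_beta borel_prod[symmetric])
    also have "\<dots> = (\<Sum>i\<in>I. \<Sum>j\<in>J. w i j * emeasure (\<nu>1 j) B)"
      unfolding sum.cartesian_product using B by (intro sum.cong refl) (auto simp: e u)
    also have "\<dots> = emeasure \<mu>1 B"
      unfolding sum.swap[of _ J I]
      using B D1(6)[OF B] w1 by (simp add: sum_distrib_right[symmetric])
    finally show "emeasure (distr \<gamma> borel snd) B = emeasure \<mu>1 B" .
  qed
  ultimately show ?thesis using \<open>prob_space \<gamma>\<close> D(2) by (simp add: couplings_def)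
qed

lemma pair_measure_in_couplings:
  fixes \<mu>0 \<mu>1 :: "'a::euclidean_space measure"
  assumes "prob_space \<mu>0" "prob_space \<mu>1" and s: "sets \<mu>0 = sets borel" "sets \<mu>1 = sets borel"
  shows "\<mu>0 \<Otimes>\<^sub>M \<mu>1 \<in> couplings \<mu>0 \<mu>1"
proof -
  have "prob_space (\<mu>0 \<Otimes>\<^sub>M \<mu>1)" by (intro prob_space_pair) fact+
  moreover have "sets (\<mu>0 \<Otimes>\<^sub>M \<mu>1) = sets borel"
    unfolding sets_pair_measure_cong[OF s] by (simp only: borel_prod)
  ultimately show ?thesis
    using distr_pair_measure_marginals[OF assms] by (simp add: couplings_def)
qed

section \<open>Gaussian mixture couplings near an arbitrary coupling\<close>

lemma square_sum3_le:
  fixes x y z a b c :: real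
  assumes "0 < a" "0 < b" "0 < c" "a + b + c = 1"
  shows "(x + y + z)\<^sup>2 \<le> x\<^sup>2 / a + y\<^sup>2 / b + z\<^sup>2 / c"
proof -
  define s where "s = x + y + z"
  \<comment> \<open>For fixed \<open>s\<close> this is \<open>(x - a s)\<^sup>2 / a \<ge> 0\<close>; summing the three tangent bounds gives the claim because the weights add up to one.\<close>
  have t: "2 * s * x - a * s\<^sup>2 \<le> x\<^sup>2 / a" if "0 < a" for a x
  proof -
    have "0 \<le> (x - a * s)\<^sup>2 / a" using that by simp
    also have "\<dots> = x\<^sup>2 / a - (2 * s * x - a * s\<^sup>2)"
      using that by (simp add: field_simps power2_eq_square)
    finally show ?thesis by simp
  qed
  have "s\<^sup>2 = (2 * s * x - a * s\<^sup>2) + (2 * s * y - b * s\<^sup>2) + (2 * s * z - c * s\<^sup>2)"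
  proof -
    have "(2 * s * x - a * s\<^sup>2) + (2 * s * y - b * s\<^sup>2) + (2 * s * z - c * s\<^sup>2) = 2 * s * s - (a + b + c) * s\<^sup>2"
      unfolding s_def by (simp add: algebra_simps)
    then show ?thesis using assms by (simp add: power2_eq_square)
  qed
  also have "\<dots> \<le> x\<^sup>2 / a + y\<^sup>2 / b + z\<^sup>2 / c"
    using t[OF assms(1), of x] t[OF assms(2), of y] t[OF assms(3), of z] by linarith
  finally show ?thesis by (simp add: s_def)
qed

text \<open>Optimising the weights turns the weighted bounds into the triangle inequality of the
  L2 norm. In this form the integrals may be estimated linearly.\<close>

lemma sqrt_le_of_weighted_bounds:
  fixes t x y z :: real
  assumes nn: "0 \<le> x" "0 \<le> y" "0 \<le> z"
    and bound: "\<And>a b c. 0 < a \<Longrightarrow> 0 < b \<Longrightarrow> 0 < c \<Longrightarrow> a + b + c = 1 \<Longrightarrow> t \<le> x\<^sup>2 / a + y\<^sup>2 / b + z\<^sup>2 / c"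
  shows "sqrt t \<le> x + y + z"
proof (rule field_le_epsilon)
  fix e :: real assume "e > 0"
  \<comment> \<open>The optimal weights are proportional to \<open>x\<close>, \<open>y\<close>, \<open>z\<close>; the shift by \<open>d\<close> keeps them positive when one of these vanishes.\<close>
  define d where "d = e / 3"
  have d: "d > 0" using \<open>e > 0\<close> by (simp add: d_def)
  define s where "s = x + y + z + e"
  have s: "s > 0" using nn \<open>e > 0\<close> by (simp add: s_def)
  have sd: "s = (x + d) + (y + d) + (z + d)" by (simp add: s_def d_def)
  have le: "u\<^sup>2 / ((u + d) / s) \<le> s * (u + d)" if "0 \<le> u" for u
  proof -
    have "u\<^sup>2 \<le> (u + d)\<^sup>2" using that d by (intro power_mono) auto
    then have "u\<^sup>2 * s \<le> (u + d) * (u + d) * s" using s by (simp add: power2_eq_square)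
    then show ?thesis using that d s by (simp add: field_simps)
  qed
  have "t \<le> x\<^sup>2 / ((x + d) / s) + y\<^sup>2 / ((y + d) / s) + z\<^sup>2 / ((z + d) / s)"
    using nn d s by (intro bound) (auto simp: add_divide_distrib[symmetric] sd)
  also have "\<dots> \<le> s * (x + d) + s * (y + d) + s * (z + d)"
    using nn by (intro add_mono le)
  also have "\<dots> = s * ((x + d) + (y + d) + (z + d))" by (simp add: algebra_simps)
  also have "\<dots> = s\<^sup>2" by (simp only: sd[symmetric] power2_eq_square)
  finally have "t \<le> s\<^sup>2" .
  then show "sqrt t \<le> x + y + z + e"
    using s by (simp add: s_def real_le_lsqrt)
qed

lemma norm_diff_square_le:
  fixes x x' y y' :: "'a::real_normed_vector"
  assumes "0 < a" "0 < b" "0 < c" "a + b + c = (1::real)"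
  shows "(norm (x - x'))\<^sup>2 \<le> (norm (y - y'))\<^sup>2 / a + (norm (x - y))\<^sup>2 / b + (norm (x' - y'))\<^sup>2 / c"
proof -
  have "x - x' = (y - y') + (x - y) - (x' - y')" by simp
  then have "norm (x - x') \<le> norm (y - y') + norm (x - y) + norm (x' - y')"
    by (metis norm_triangle_ineq4 norm_triangle_ineq add_right_mono order_trans)
  then have "(norm (x - x'))\<^sup>2 \<le> (norm (y - y') + norm (x - y) + norm (x' - y'))\<^sup>2"
    by (simp add: power_mono)
  also have "\<dots> \<le> (norm (y - y'))\<^sup>2 / a + (norm (x - y))\<^sup>2 / b + (norm (x' - y'))\<^sup>2 / c"
    by (rule square_sum3_le) fact+
  finally show ?thesis .
qed

lemma nn_integral_dist_square_le:
  fixes \<nu>0 \<nu>1 :: "'a::euclidean_space measure"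
  assumes mc: "has_mean_cov \<nu>0 m0 S0" "has_mean_cov \<nu>1 m1 S1"
    and abc: "0 < a" "0 < b" "0 < c" "a + b + c = (1::real)"
  shows "(\<integral>\<^sup>+x'. \<integral>\<^sup>+x. ennreal ((norm (x - x'))\<^sup>2) \<partial>\<nu>0 \<partial>\<nu>1)
    \<le> ennreal (1 / a) * ennreal ((norm (y - y'))\<^sup>2)
      + ennreal (1 / b) * (\<integral>\<^sup>+x. ennreal ((norm (x - y))\<^sup>2) \<partial>\<nu>0)
      + ennreal (1 / c) * (\<integral>\<^sup>+x'. ennreal ((norm (x' - y'))\<^sup>2) \<partial>\<nu>1)"
proof -
  interpret M: prob_space \<nu>0 using mc(1) by (rule has_mean_covD)
  interpret N: prob_space \<nu>1 using mc(2) by (rule has_mean_covD)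
  have [measurable_cong]: "sets \<nu>0 = sets borel" "sets \<nu>1 = sets borel"
    using mc by (simp_all add: has_mean_covD)
  let ?r = "ennreal (1 / a) * ennreal ((norm (y - y'))\<^sup>2)"
  have "(\<integral>\<^sup>+x'. \<integral>\<^sup>+x. ennreal ((norm (x - x'))\<^sup>2) \<partial>\<nu>0 \<partial>\<nu>1)
    \<le> (\<integral>\<^sup>+x'. \<integral>\<^sup>+x. ?r + ennreal (1 / b) * ennreal ((norm (x - y))\<^sup>2)
          + ennreal (1 / c) * ennreal ((norm (x' - y'))\<^sup>2) \<partial>\<nu>0 \<partial>\<nu>1)"
  proof (intro nn_integral_mono)
    fix x x'
    have "ennreal ((norm (x - x'))\<^sup>2) \<le> ennreal (1 / a * (norm (y - y'))\<^sup>2 + 1 / b * (norm (x - y))\<^sup>2 + 1 / c * (norm (x' - y'))\<^sup>2)"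
      using norm_diff_square_le[OF abc, of x x' y y'] by (intro ennreal_leI) simp
    also have "\<dots> = ?r + ennreal (1 / b) * ennreal ((norm (x - y))\<^sup>2) + ennreal (1 / c) * ennreal ((norm (x' - y'))\<^sup>2)"
      using abc by (simp add: ennreal_plus[symmetric] ennreal_mult[symmetric] del: ennreal_plus)
    finally show "ennreal ((norm (x - x'))\<^sup>2) \<le> \<dots>" .
  qed
  also have "\<dots> = (\<integral>\<^sup>+x'. ?r + ennreal (1 / b) * (\<integral>\<^sup>+x. ennreal ((norm (x - y))\<^sup>2) \<partial>\<nu>0)
          + ennreal (1 / c) * ennreal ((norm (x' - y'))\<^sup>2) \<partial>\<nu>1)"
    by (intro nn_integral_cong) (simp add: nn_integral_add nn_integral_cmult M.emeasure_space_1)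
  also have "\<dots> = ?r + ennreal (1 / b) * (\<integral>\<^sup>+x. ennreal ((norm (x - y))\<^sup>2) \<partial>\<nu>0)
      + ennreal (1 / c) * (\<integral>\<^sup>+x'. ennreal ((norm (x' - y'))\<^sup>2) \<partial>\<nu>1)"
    by (simp add: nn_integral_add nn_integral_cmult N.emeasure_space_1)
  finally show ?thesis .
qed

text \<open>Draw \<open>(y, y')\<close> from \<open>\<gamma>\<close>, labels \<open>i\<close>, \<open>j\<close> from their posteriors given \<open>y\<close> and \<open>y'\<close>, and fresh independent
  points \<open>x\<close>, \<open>x'\<close> from the components \<open>i\<close> and \<open>j\<close>. The left-hand side is the mean of
  \<open>(norm (x - x'))\<^sup>2\<close>. Given its label, \<open>y\<close> is an independent copy of \<open>x\<close>, and likewise for \<open>y'\<close> and \<open>x'\<close>,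
  which gives the last two terms on the right.\<close>

lemma coupling_label_weights:
  fixes \<mu>0 \<mu>1 :: "'a::euclidean_space measure"
  assumes \<gamma>: "\<gamma> \<in> couplings \<mu>0 \<mu>1"
    and mix0: "mixture_of \<mu>0 I c0 \<nu>0" and mix1: "mixture_of \<mu>1 J c1 \<nu>1"
    and mc0: "\<And>i. i \<in> I \<Longrightarrow> has_mean_cov (\<nu>0 i) (m0 i) (S0 i)"
    and mc1: "\<And>j. j \<in> J \<Longrightarrow> has_mean_cov (\<nu>1 j) (m1 j) (S1 j)"
  obtains w where "\<And>i. i \<in> I \<Longrightarrow> (\<Sum>j\<in>J. w i j) = c0 i" "\<And>j. j \<in> J \<Longrightarrow> (\<Sum>i\<in>I. w i j) = c1 j"
    "\<And>a b c::real. 0 < a \<Longrightarrow> 0 < b \<Longrightarrow> 0 < c \<Longrightarrow> a + b + c = 1 \<Longrightarrow>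
      (\<Sum>i\<in>I. \<Sum>j\<in>J. w i j * (\<integral>\<^sup>+y. \<integral>\<^sup>+x. ennreal ((norm (x - y))\<^sup>2) \<partial>\<nu>0 i \<partial>\<nu>1 j))
      \<le> ennreal (1 / a) * transport_cost \<gamma>
        + ennreal (1 / b) * (\<Sum>i\<in>I. c0 i * (\<integral>\<^sup>+y. \<integral>\<^sup>+x. ennreal ((norm (x - y))\<^sup>2) \<partial>\<nu>0 i \<partial>\<nu>0 i))
        + ennreal (1 / c) * (\<Sum>j\<in>J. c1 j * (\<integral>\<^sup>+y. \<integral>\<^sup>+x. ennreal ((norm (x - y))\<^sup>2) \<partial>\<nu>1 j \<partial>\<nu>1 j))"
proof -
  have s[measurable_cong]: "sets \<gamma> = sets borel" and pg: "prob_space \<gamma>"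
    and d0: "distr \<gamma> borel fst = \<mu>0" and d1: "distr \<gamma> borel snd = \<mu>1"
    using \<gamma> by (auto simp: couplings_def)
  interpret G: prob_space \<gamma> by (rule pg)
  have m: "fst \<in> measurable \<gamma> borel" "snd \<in> measurable \<gamma> borel" by simp_all
  have "prob_space \<mu>0" "prob_space \<mu>1"
    unfolding d0[symmetric] d1[symmetric] using m by (auto intro: G.prob_space_distr)
  obtain f where f: "\<And>i. i \<in> I \<Longrightarrow> f i \<in> borel_measurable borel"
    "\<And>i h. i \<in> I \<Longrightarrow> h \<in> borel_measurable borel \<Longrightarrow> (\<integral>\<^sup>+x. f i x * h x \<partial>\<mu>0) = c0 i * (\<integral>\<^sup>+x. h x \<partial>\<nu>0 i)"
    "AE x in \<mu>0. (\<Sum>i\<in>I. f i x) = 1"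
    using mixture_densities[OF mix0 \<open>prob_space \<mu>0\<close>] by blast
  obtain g where g: "\<And>j. j \<in> J \<Longrightarrow> g j \<in> borel_measurable borel"
    "\<And>j h. j \<in> J \<Longrightarrow> h \<in> borel_measurable borel \<Longrightarrow> (\<integral>\<^sup>+x. g j x * h x \<partial>\<mu>1) = c1 j * (\<integral>\<^sup>+x. h x \<partial>\<nu>1 j)"
    "AE x in \<mu>1. (\<Sum>j\<in>J. g j x) = 1"
    using mixture_densities[OF mix1 \<open>prob_space \<mu>1\<close>] by blast
  have AEf: "AE p in \<gamma>. (\<Sum>i\<in>I. f i (fst p)) = 1"
    using f(3) unfolding d0[symmetric] by (rule AE_distrD[OF m(1)])
  have AEg: "AE p in \<gamma>. (\<Sum>j\<in>J. g j (snd p)) = 1"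
    using g(3) unfolding d1[symmetric] by (rule AE_distrD[OF m(2)])
  have mf: "(\<lambda>p. f i (fst p)) \<in> borel_measurable \<gamma>" if "i \<in> I" for i
    by (rule measurable_compose[OF m(1) f(1)[OF that]])
  have mg: "(\<lambda>p. g j (snd p)) \<in> borel_measurable \<gamma>" if "j \<in> J" for j
    by (rule measurable_compose[OF m(2) g(1)[OF that]])
  have int_f: "(\<integral>\<^sup>+p. f i (fst p) * h (fst p) \<partial>\<gamma>) = c0 i * (\<integral>\<^sup>+x. h x \<partial>\<nu>0 i)"
    if "i \<in> I" "h \<in> borel_measurable borel" for i h
    using f(2)[OF that] f(1)[OF that(1)] that(2) m unfolding d0[symmetric]
    by (subst (asm) nn_integral_distr) auto
  have int_g: "(\<integral>\<^sup>+p. g j (snd p) * h (snd p) \<partial>\<gamma>) = c1 j * (\<integral>\<^sup>+x. h x \<partial>\<nu>1 j)"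
    if "j \<in> J" "h \<in> borel_measurable borel" for j h
    using g(2)[OF that] g(1)[OF that(1)] that(2) m unfolding d1[symmetric]
    by (subst (asm) nn_integral_distr) auto
  have fin: "finite I" "finite J" using mix0 mix1 by (auto simp: mixture_of_def)
  have u0: "(\<integral>\<^sup>+x. 1 \<partial>\<nu>0 i) = 1" if "i \<in> I" for i
    using prob_space.emeasure_space_1[OF has_mean_covD(1)[OF mc0[OF that]]] by simp
  have u1: "(\<integral>\<^sup>+x. 1 \<partial>\<nu>1 j) = 1" if "j \<in> J" for j
    using prob_space.emeasure_space_1[OF has_mean_covD(1)[OF mc1[OF that]]] by simp
  \<comment> \<open>\<open>f i\<close> and \<open>g j\<close> are the posterior probabilities of the labels, so \<open>w i j\<close> is the probability of the pair of labels when the labels are drawn independently given the two points.\<close>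
  define w where "w i j = (\<integral>\<^sup>+p. f i (fst p) * g j (snd p) \<partial>\<gamma>)" for i j
  define E0 where "E0 i y = (\<integral>\<^sup>+x. ennreal ((norm (x - y))\<^sup>2) \<partial>\<nu>0 i)" for i y
  define E1 where "E1 j y = (\<integral>\<^sup>+x. ennreal ((norm (x - y))\<^sup>2) \<partial>\<nu>1 j)" for j y
  have mE0: "E0 i \<in> borel_measurable borel" if "i \<in> I" for i
    unfolding E0_def has_mean_cov_nn_integral_dist[OF mc0[OF that]] by measurable
  have mE1: "E1 j \<in> borel_measurable borel" if "j \<in> J" for j
    unfolding E1_def has_mean_cov_nn_integral_dist[OF mc1[OF that]] by measurable
  have mE0': "(\<lambda>p. E0 i (fst p)) \<in> borel_measurable \<gamma>" if "i \<in> I" for i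
    by (rule measurable_compose[OF m(1) mE0[OF that]])
  have mE1': "(\<lambda>p. E1 j (snd p)) \<in> borel_measurable \<gamma>" if "j \<in> J" for j
    by (rule measurable_compose[OF m(2) mE1[OF that]])
  define r where "r p = ennreal ((norm (fst p - snd p))\<^sup>2)" for p :: "'a \<times> 'a"
  have mr: "r \<in> borel_measurable \<gamma>" unfolding r_def by measurable
  show ?thesis
  proof (rule that[of w])
    fix i assume i: "i \<in> I"
    have "(\<Sum>j\<in>J. w i j) = (\<integral>\<^sup>+p. f i (fst p) * (\<Sum>j\<in>J. g j (snd p)) \<partial>\<gamma>)"
      unfolding w_def sum_distrib_left using mf[OF i] mg by (intro nn_integral_sum[symmetric]) auto
    also have "\<dots> = (\<integral>\<^sup>+p. f i (fst p) * 1 \<partial>\<gamma>)"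
      using AEg by (intro nn_integral_cong_AE) auto
    also have "\<dots> = c0 i" using int_f[OF i, of "\<lambda>_. 1"] u0[OF i] by simp
    finally show "(\<Sum>j\<in>J. w i j) = c0 i" .
  next
    fix j assume j: "j \<in> J"
    have "(\<Sum>i\<in>I. w i j) = (\<integral>\<^sup>+p. (\<Sum>i\<in>I. f i (fst p)) * g j (snd p) \<partial>\<gamma>)"
      unfolding w_def sum_distrib_right using mf mg[OF j] by (intro nn_integral_sum[symmetric]) auto
    also have "\<dots> = (\<integral>\<^sup>+p. g j (snd p) * 1 \<partial>\<gamma>)"
      using AEf by (intro nn_integral_cong_AE) auto
    also have "\<dots> = c1 j" using int_g[OF j, of "\<lambda>_. 1"] u1[OF j] by simp
    finally show "(\<Sum>i\<in>I. w i j) = c1 j" .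
  next
    fix a b c :: real assume abc: "0 < a" "0 < b" "0 < c" "a + b + c = 1"
    define A B C where "A = ennreal (1 / a)" and "B = ennreal (1 / b)" and "C = ennreal (1 / c)"
    let ?D = "\<lambda>i j. \<integral>\<^sup>+y. \<integral>\<^sup>+x. ennreal ((norm (x - y))\<^sup>2) \<partial>\<nu>0 i \<partial>\<nu>1 j"
    let ?R = "\<lambda>i j p. A * r p + B * E0 i (fst p) + C * E1 j (snd p)"
    \<comment> \<open>The bound on \<open>?D i j\<close> holds for every pair of points, so it may be averaged over the pair that carries the labels.\<close>
    have "(\<Sum>i\<in>I. \<Sum>j\<in>J. w i j * ?D i j) \<le> (\<Sum>i\<in>I. \<Sum>j\<in>J. \<integral>\<^sup>+p. f i (fst p) * g j (snd p) * ?R i j p \<partial>\<gamma>)"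
    proof (intro sum_mono)
      fix i j assume i: "i \<in> I" and j: "j \<in> J"
      have "w i j * ?D i j = (\<integral>\<^sup>+p. f i (fst p) * g j (snd p) * ?D i j \<partial>\<gamma>)"
        unfolding w_def using mf[OF i] mg[OF j] by (intro nn_integral_multc[symmetric]) auto
      also have "\<dots> \<le> (\<integral>\<^sup>+p. f i (fst p) * g j (snd p) * ?R i j p \<partial>\<gamma>)"
        unfolding A_def B_def C_def r_def E0_def E1_def
        by (intro nn_integral_mono mult_left_mono nn_integral_dist_square_le[OF mc0[OF i] mc1[OF j] abc]) simp
      finally show "w i j * ?D i j \<le> \<dots>" .
    qed
    also have "\<dots> = (\<integral>\<^sup>+p. (\<Sum>i\<in>I. \<Sum>j\<in>J. f i (fst p) * g j (snd p) * ?R i j p) \<partial>\<gamma>)"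
    proof -
      have mR: "(\<lambda>p. f i (fst p) * g j (snd p) * ?R i j p) \<in> borel_measurable \<gamma>" if "i \<in> I" "j \<in> J" for i j
        using mf[OF that(1)] mg[OF that(2)] mr mE0'[OF that(1)] mE1'[OF that(2)] by measurable
      have "(\<Sum>i\<in>I. \<Sum>j\<in>J. \<integral>\<^sup>+p. f i (fst p) * g j (snd p) * ?R i j p \<partial>\<gamma>)
          = (\<Sum>i\<in>I. \<integral>\<^sup>+p. (\<Sum>j\<in>J. f i (fst p) * g j (snd p) * ?R i j p) \<partial>\<gamma>)"
        by (intro sum.cong refl nn_integral_sum[symmetric] mR)
      also have "\<dots> = (\<integral>\<^sup>+p. (\<Sum>i\<in>I. \<Sum>j\<in>J. f i (fst p) * g j (snd p) * ?R i j p) \<partial>\<gamma>)"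
        by (intro nn_integral_sum[symmetric] borel_measurable_sum mR)
      finally show ?thesis .
    qed
    also have "\<dots> = (\<integral>\<^sup>+p. A * r p + B * (\<Sum>i\<in>I. f i (fst p) * E0 i (fst p)) + C * (\<Sum>j\<in>J. g j (snd p) * E1 j (snd p)) \<partial>\<gamma>)"
    proof (rule nn_integral_cong_AE)
      have eq: "(\<Sum>i\<in>I. \<Sum>j\<in>J. f i (fst p) * g j (snd p) * ?R i j p)
        = A * r p * ((\<Sum>i\<in>I. f i (fst p)) * (\<Sum>j\<in>J. g j (snd p)))
          + B * ((\<Sum>i\<in>I. f i (fst p) * E0 i (fst p)) * (\<Sum>j\<in>J. g j (snd p)))
          + C * ((\<Sum>i\<in>I. f i (fst p)) * (\<Sum>j\<in>J. g j (snd p) * E1 j (snd p)))" for p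
      proof -
        have "(\<Sum>i\<in>I. \<Sum>j\<in>J. f i (fst p) * g j (snd p) * ?R i j p)
          = (\<Sum>i\<in>I. \<Sum>j\<in>J. A * r p * (f i (fst p) * g j (snd p))
              + B * ((f i (fst p) * E0 i (fst p)) * g j (snd p))
              + C * (f i (fst p) * (g j (snd p) * E1 j (snd p))))"
          by (simp only: distrib_left mult_ac)
        also have "\<dots> = A * r p * (\<Sum>i\<in>I. \<Sum>j\<in>J. f i (fst p) * g j (snd p))
              + B * (\<Sum>i\<in>I. \<Sum>j\<in>J. (f i (fst p) * E0 i (fst p)) * g j (snd p))
              + C * (\<Sum>i\<in>I. \<Sum>j\<in>J. f i (fst p) * (g j (snd p) * E1 j (snd p)))"
          by (simp only: sum.distrib sum_distrib_left)
        finally show ?thesis by (simp only: sum_product)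
      qed
      show "AE p in \<gamma>. (\<Sum>i\<in>I. \<Sum>j\<in>J. f i (fst p) * g j (snd p) * ?R i j p)
        = A * r p + B * (\<Sum>i\<in>I. f i (fst p) * E0 i (fst p)) + C * (\<Sum>j\<in>J. g j (snd p) * E1 j (snd p))"
        using AEf AEg by eventually_elim (simp add: eq)
    qed
    also have "\<dots> = A * (\<integral>\<^sup>+p. r p \<partial>\<gamma>) + B * (\<Sum>i\<in>I. \<integral>\<^sup>+p. f i (fst p) * E0 i (fst p) \<partial>\<gamma>)
          + C * (\<Sum>j\<in>J. \<integral>\<^sup>+p. g j (snd p) * E1 j (snd p) \<partial>\<gamma>)"
      using mf mg mr mE0' mE1' by (simp add: nn_integral_add nn_integral_cmult nn_integral_sum)
    also have "\<dots> = A * transport_cost \<gamma> + B * (\<Sum>i\<in>I. c0 i * (\<integral>\<^sup>+y. E0 i y \<partial>\<nu>0 i))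
          + C * (\<Sum>j\<in>J. c1 j * (\<integral>\<^sup>+y. E1 j y \<partial>\<nu>1 j))"
      using int_f[OF _ mE0] int_g[OF _ mE1] by (simp add: transport_cost_def r_def)
    finally show "(\<Sum>i\<in>I. \<Sum>j\<in>J. w i j * ?D i j)
      \<le> ennreal (1 / a) * transport_cost \<gamma>
        + ennreal (1 / b) * (\<Sum>i\<in>I. c0 i * (\<integral>\<^sup>+y. \<integral>\<^sup>+x. ennreal ((norm (x - y))\<^sup>2) \<partial>\<nu>0 i \<partial>\<nu>0 i))
        + ennreal (1 / c) * (\<Sum>j\<in>J. c1 j * (\<integral>\<^sup>+y. \<integral>\<^sup>+x. ennreal ((norm (x - y))\<^sup>2) \<partial>\<nu>1 j \<partial>\<nu>1 j))"
      by (simp only: A_def B_def C_def E0_def E1_def)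
  qed
qed

text \<open>The fresh points of the preceding construction form the required Gaussian mixture: conditionally on the
  labels they are independent Gaussians, hence jointly Gaussian.\<close>

lemma GMM_coupling_near_coupling:
  fixes \<mu>0 \<mu>1 :: "'a::euclidean_space measure"
  assumes \<gamma>: "\<gamma> \<in> couplings \<mu>0 \<mu>1"
    and mix0: "mixture_of \<mu>0 I c0 \<nu>0" "(\<Sum>i\<in>I. c0 i) = 1" and mix1: "mixture_of \<mu>1 J c1 \<nu>1"
    and g0: "\<And>i. i \<in> I \<Longrightarrow> is_gaussian (\<nu>0 i) (m0 i) (S0 i)"
    and g1: "\<And>j. j \<in> J \<Longrightarrow> is_gaussian (\<nu>1 j) (m1 j) (S1 j)"
  shows "\<exists>\<gamma>'\<in>couplings \<mu>0 \<mu>1 \<inter> GMM_fin. \<forall>a b c::real. 0 < a \<and> 0 < b \<and> 0 < c \<and> a + b + c = 1 \<longrightarrow>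
      transport_cost \<gamma>' \<le> ennreal (1 / a) * transport_cost \<gamma>
        + ennreal (1 / b) * (\<Sum>i\<in>I. c0 i * ennreal (2 * (\<Sum>e\<in>Basis. e \<bullet> S0 i e)))
        + ennreal (1 / c) * (\<Sum>j\<in>J. c1 j * ennreal (2 * (\<Sum>e\<in>Basis. e \<bullet> S1 j e)))"
proof -
  have mc0: "has_mean_cov (\<nu>0 i) (m0 i) (S0 i)" if "i \<in> I" for i
    using is_gaussian_has_mean_cov[OF g0[OF that]] .
  have mc1: "has_mean_cov (\<nu>1 j) (m1 j) (S1 j)" if "j \<in> J" for j
    using is_gaussian_has_mean_cov[OF g1[OF that]] .
  have p0: "\<And>i. i \<in> I \<Longrightarrow> prob_space (\<nu>0 i)" and p1: "\<And>j. j \<in> J \<Longrightarrow> prob_space (\<nu>1 j)"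
    using mc0 mc1 by (blast intro: has_mean_covD(1))+
  obtain w where w0: "\<And>i. i \<in> I \<Longrightarrow> (\<Sum>j\<in>J. w i j) = c0 i"
    and w1: "\<And>j. j \<in> J \<Longrightarrow> (\<Sum>i\<in>I. w i j) = c1 j"
    and bound: "\<And>a b c::real. 0 < a \<Longrightarrow> 0 < b \<Longrightarrow> 0 < c \<Longrightarrow> a + b + c = 1 \<Longrightarrow>
      (\<Sum>i\<in>I. \<Sum>j\<in>J. w i j * (\<integral>\<^sup>+y. \<integral>\<^sup>+x. ennreal ((norm (x - y))\<^sup>2) \<partial>\<nu>0 i \<partial>\<nu>1 j))
      \<le> ennreal (1 / a) * transport_cost \<gamma>
        + ennreal (1 / b) * (\<Sum>i\<in>I. c0 i * (\<integral>\<^sup>+y. \<integral>\<^sup>+x. ennreal ((norm (x - y))\<^sup>2) \<partial>\<nu>0 i \<partial>\<nu>0 i))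
        + ennreal (1 / c) * (\<Sum>j\<in>J. c1 j * (\<integral>\<^sup>+y. \<integral>\<^sup>+x. ennreal ((norm (x - y))\<^sup>2) \<partial>\<nu>1 j \<partial>\<nu>1 j))"
    using coupling_label_weights[OF \<gamma> mix0(1) mix1 mc0 mc1] by blast
  note D0 = mixture_ofD[OF mix0(1)] and D1 = mixture_ofD[OF mix1]
  let ?W = "\<lambda>(i, j). w i j" and ?N = "\<lambda>(i, j). \<nu>0 i \<Otimes>\<^sub>M \<nu>1 j"
  have "sets (?N p) = sets borel" if "p \<in> I \<times> J" for p
    using that sets_pair_measure_cong[OF D0(4) D1(4)] by (auto simp only: borel_prod split: prod.split)
  then obtain \<gamma>' where mix: "mixture_of \<gamma>' (I \<times> J) ?W ?N"
    using mixture_of_exists[of "I \<times> J" ?N ?W] D0(1) D1(1) by auto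
  have "\<gamma>' \<in> couplings \<mu>0 \<mu>1"
    using mixture_couplings[OF mix0(1) mix1 p0 p1 w0 w1 mix0(2) mix] .
  moreover have "\<gamma>' \<in> GMM_fin"
  proof (rule GMM_finI[OF mix])
    show "(\<Sum>p\<in>I \<times> J. ?W p) = 1"
      using w0 mix0(2) by (simp add: sum.cartesian_product[symmetric])
    show "\<exists>m S. is_gaussian (?N p) m S" if "p \<in> I \<times> J" for p
      using that is_gaussian_pair_measure[OF g0 g1] by auto
  qed
  moreover have "transport_cost \<gamma>' \<le> ennreal (1 / a) * transport_cost \<gamma>
        + ennreal (1 / b) * (\<Sum>i\<in>I. c0 i * ennreal (2 * (\<Sum>e\<in>Basis. e \<bullet> S0 i e)))
        + ennreal (1 / c) * (\<Sum>j\<in>J. c1 j * ennreal (2 * (\<Sum>e\<in>Basis. e \<bullet> S1 j e)))"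
    if abc: "0 < a" "0 < b" "0 < c" "a + b + c = 1" for a b c :: real
  proof -
    have "transport_cost \<gamma>' = (\<Sum>p\<in>I \<times> J. ?W p * transport_cost (?N p))"
      unfolding transport_cost_def by (rule nn_integral_mixture_of[OF mix]) simp
    also have "\<dots> = (\<Sum>i\<in>I. \<Sum>j\<in>J. w i j * (\<integral>\<^sup>+y. \<integral>\<^sup>+x. ennreal ((norm (x - y))\<^sup>2) \<partial>\<nu>0 i \<partial>\<nu>1 j))"
      unfolding sum.cartesian_product
      by (intro sum.cong refl) (auto simp: transport_cost_product[OF mc0 mc1])
    also note bound[OF abc]
    also have "(\<Sum>i\<in>I. c0 i * (\<integral>\<^sup>+y. \<integral>\<^sup>+x. ennreal ((norm (x - y))\<^sup>2) \<partial>\<nu>0 i \<partial>\<nu>0 i))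
      = (\<Sum>i\<in>I. c0 i * ennreal (2 * (\<Sum>e\<in>Basis. e \<bullet> S0 i e)))"
      by (intro sum.cong refl) (simp add: has_mean_cov_nn_integral_independent[OF mc0 mc0])
    also have "(\<Sum>j\<in>J. c1 j * (\<integral>\<^sup>+y. \<integral>\<^sup>+x. ennreal ((norm (x - y))\<^sup>2) \<partial>\<nu>1 j \<partial>\<nu>1 j))
      = (\<Sum>j\<in>J. c1 j * ennreal (2 * (\<Sum>e\<in>Basis. e \<bullet> S1 j e)))"
      by (intro sum.cong refl) (simp add: has_mean_cov_nn_integral_independent[OF mc1 mc1])
    finally show ?thesis .
  qed
  ultimately show ?thesis by blast
qed

lemma GMM_couplings_nonempty:
  fixes \<mu>0 \<mu>1 :: "'a::euclidean_space measure"
  assumes "\<mu>0 \<in> GMM_fin" "\<mu>1 \<in> GMM_fin"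
  shows "couplings \<mu>0 \<mu>1 \<inter> GMM_fin \<noteq> {}"
proof -
  obtain K0 :: nat and c0 \<nu>0 where 0: "mixture_of \<mu>0 {..<K0} c0 \<nu>0" "(\<Sum>k<K0. c0 k) = 1"
    "\<And>k. k < K0 \<Longrightarrow> \<exists>m S. is_gaussian (\<nu>0 k) m S"
    using GMM_finE[OF assms(1)] by metis
  obtain K1 :: nat and c1 \<nu>1 where 1: "mixture_of \<mu>1 {..<K1} c1 \<nu>1" "(\<Sum>k<K1. c1 k) = 1"
    "\<And>k. k < K1 \<Longrightarrow> \<exists>m S. is_gaussian (\<nu>1 k) m S"
    using GMM_finE[OF assms(2)] by metis
  obtain m0 S0 where g0: "\<And>k. k \<in> {..<K0} \<Longrightarrow> is_gaussian (\<nu>0 k) (m0 k) (S0 k)"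
    using 0(3) by (metis lessThan_iff)
  obtain m1 S1 where g1: "\<And>k. k \<in> {..<K1} \<Longrightarrow> is_gaussian (\<nu>1 k) (m1 k) (S1 k)"
    using 1(3) by (metis lessThan_iff)
  have "\<mu>0 \<Otimes>\<^sub>M \<mu>1 \<in> couplings \<mu>0 \<mu>1"
    using assms by (intro pair_measure_in_couplings GMM_fin_prob_space GMM_fin_sets)
  then show ?thesis
    using GMM_coupling_near_coupling[OF _ 0(1,2) 1(1) g0 g1] by blast
qed

section \<open>Comparison of the two distances\<close>

text \<open>Since all costs are finite, the truncation to real numbers in the definitions is harmless.\<close>

lemma W2_square:
  fixes \<mu>0 \<mu>1 :: "'a::euclidean_space measure"
  assumes "\<mu>0 \<in> GMM_fin" "\<mu>1 \<in> GMM_fin"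
  shows "ennreal ((W2 \<mu>0 \<mu>1)\<^sup>2) = (INF \<gamma>\<in>couplings \<mu>0 \<mu>1. transport_cost \<gamma>)"
    and "ennreal ((MW2 \<mu>0 \<mu>1)\<^sup>2) = (INF \<gamma>\<in>couplings \<mu>0 \<mu>1 \<inter> GMM_fin. transport_cost \<gamma>)"
    and "0 \<le> W2 \<mu>0 \<mu>1" "0 \<le> MW2 \<mu>0 \<mu>1"
proof -
  obtain \<gamma> where \<gamma>: "\<gamma> \<in> couplings \<mu>0 \<mu>1 \<inter> GMM_fin" using GMM_couplings_nonempty[OF assms] by blast
  then have fin: "transport_cost \<gamma> < \<infinity>" using assms by (intro GMM_coupling_cost_finite[of \<mu>0 \<mu>1]) auto
  have "(INF \<gamma>\<in>couplings \<mu>0 \<mu>1. transport_cost \<gamma>) < \<infinity>"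
    using \<gamma> fin by (auto simp: INF_less_iff)
  then show "ennreal ((W2 \<mu>0 \<mu>1)\<^sup>2) = (INF \<gamma>\<in>couplings \<mu>0 \<mu>1. transport_cost \<gamma>)"
    by (simp add: W2_def ennreal_enn2real)
  have "(INF \<gamma>\<in>couplings \<mu>0 \<mu>1 \<inter> GMM_fin. transport_cost \<gamma>) < \<infinity>"
    using \<gamma> fin by (auto simp: INF_less_iff)
  then show "ennreal ((MW2 \<mu>0 \<mu>1)\<^sup>2) = (INF \<gamma>\<in>couplings \<mu>0 \<mu>1 \<inter> GMM_fin. transport_cost \<gamma>)"
    by (simp add: MW2_def ennreal_enn2real)
qed (simp_all add: W2_def MW2_def)

lemma W2_le_MW2:
  fixes \<mu>0 \<mu>1 :: "'a::euclidean_space measure"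
  assumes "\<mu>0 \<in> GMM_fin" "\<mu>1 \<in> GMM_fin"
  shows "W2 \<mu>0 \<mu>1 \<le> MW2 \<mu>0 \<mu>1"
proof -
  note W = W2_square[OF assms]
  have "ennreal ((W2 \<mu>0 \<mu>1)\<^sup>2) \<le> ennreal ((MW2 \<mu>0 \<mu>1)\<^sup>2)"
    unfolding W by (intro INF_superset_mono) auto
  then have "(W2 \<mu>0 \<mu>1)\<^sup>2 \<le> (MW2 \<mu>0 \<mu>1)\<^sup>2" by simp
  then show ?thesis using W(4) by (rule power2_le_imp_le)
qed

lemma W2_eq_MW2I:
  fixes \<mu>0 \<mu>1 :: "'a::euclidean_space measure"
  assumes "\<mu>0 \<in> GMM_fin" "\<mu>1 \<in> GMM_fin"
    and ex: "\<And>\<gamma>. \<gamma> \<in> couplings \<mu>0 \<mu>1 \<Longrightarrow>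
      \<exists>\<gamma>'\<in>couplings \<mu>0 \<mu>1 \<inter> GMM_fin. transport_cost \<gamma>' \<le> transport_cost \<gamma>"
  shows "W2 \<mu>0 \<mu>1 = MW2 \<mu>0 \<mu>1"
proof (rule antisym)
  show "W2 \<mu>0 \<mu>1 \<le> MW2 \<mu>0 \<mu>1" by (rule W2_le_MW2) fact+
  note W = W2_square[OF assms(1,2)]
  have "ennreal ((MW2 \<mu>0 \<mu>1)\<^sup>2) \<le> ennreal ((W2 \<mu>0 \<mu>1)\<^sup>2)"
    unfolding W by (intro INF_mono ex)
  then have "(MW2 \<mu>0 \<mu>1)\<^sup>2 \<le> (W2 \<mu>0 \<mu>1)\<^sup>2" by simp
  then show "MW2 \<mu>0 \<mu>1 \<le> W2 \<mu>0 \<mu>1" using W(3) by (rule power2_le_imp_le)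
qed

lemma MW2_upper_bound:
  fixes \<mu>0 \<mu>1 :: "(real^'d) measure"
  assumes m0: "is_gaussian_mixture \<mu>0 K0 \<pi>0 m0 (\<lambda>k. (*v) (\<Sigma>0 k))"
    and m1: "is_gaussian_mixture \<mu>1 K1 \<pi>1 m1 (\<lambda>k. (*v) (\<Sigma>1 k))"
  shows "MW2 \<mu>0 \<mu>1 \<le> W2 \<mu>0 \<mu>1
         + (sqrt (2 * (\<Sum>k<K0. \<pi>0 k * trace (\<Sigma>0 k)))
          + sqrt (2 * (\<Sum>k<K1. \<pi>1 k * trace (\<Sigma>1 k))))"
proof -
  have G: "\<mu>0 \<in> GMM_fin" "\<mu>1 \<in> GMM_fin" using m0 m1 by (auto simp: GMM_fin_def GMM_def)
  note W = W2_square[OF G]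
  obtain \<nu>0 where 0: "mixture_of \<mu>0 {..<K0} (\<lambda>k. ennreal (\<pi>0 k)) \<nu>0" "(\<Sum>k<K0. ennreal (\<pi>0 k)) = 1"
    "\<And>k. k < K0 \<Longrightarrow> 0 \<le> \<pi>0 k" "\<And>k. k < K0 \<Longrightarrow> is_gaussian (\<nu>0 k) (m0 k) ((*v) (\<Sigma>0 k))"
    using is_gaussian_mixture_mixture_of[OF m0] by metis
  obtain \<nu>1 where 1: "mixture_of \<mu>1 {..<K1} (\<lambda>k. ennreal (\<pi>1 k)) \<nu>1" "(\<Sum>k<K1. ennreal (\<pi>1 k)) = 1"
    "\<And>k. k < K1 \<Longrightarrow> 0 \<le> \<pi>1 k" "\<And>k. k < K1 \<Longrightarrow> is_gaussian (\<nu>1 k) (m1 k) ((*v) (\<Sigma>1 k))"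
    using is_gaussian_mixture_mixture_of[OF m1] by metis
  have g0: "\<And>k. k \<in> {..<K0} \<Longrightarrow> is_gaussian (\<nu>0 k) (m0 k) ((*v) (\<Sigma>0 k))"
    and g1: "\<And>k. k \<in> {..<K1} \<Longrightarrow> is_gaussian (\<nu>1 k) (m1 k) ((*v) (\<Sigma>1 k))"
    using 0(4) 1(4) by simp_all
  have t0: "0 \<le> trace (\<Sigma>0 k)" if "k < K0" for k
    unfolding trace_eq_sum_Basis
    by (rule sum_nonneg) (rule has_mean_cov_second_moment(2)[OF is_gaussian_has_mean_cov[OF 0(4)[OF that]]])
  have t1: "0 \<le> trace (\<Sigma>1 k)" if "k < K1" for k
    unfolding trace_eq_sum_Basis
    by (rule sum_nonneg) (rule has_mean_cov_second_moment(2)[OF is_gaussian_has_mean_cov[OF 1(4)[OF that]]])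
  define T0 where "T0 = 2 * (\<Sum>k<K0. \<pi>0 k * trace (\<Sigma>0 k))"
  define T1 where "T1 = 2 * (\<Sum>k<K1. \<pi>1 k * trace (\<Sigma>1 k))"
  have e0: "(\<Sum>k<K0. ennreal (\<pi>0 k) * ennreal (2 * trace (\<Sigma>0 k))) = ennreal T0"
  proof -
    have "(\<Sum>k<K0. ennreal (\<pi>0 k) * ennreal (2 * trace (\<Sigma>0 k))) = (\<Sum>k<K0. ennreal (\<pi>0 k * (2 * trace (\<Sigma>0 k))))"
      using 0(3) t0 by (intro sum.cong refl) (simp add: ennreal_mult)
    also have "\<dots> = ennreal (\<Sum>k<K0. \<pi>0 k * (2 * trace (\<Sigma>0 k)))"
      using 0(3) t0 by (intro sum_ennreal) simp
    finally show ?thesis by (simp add: T0_def sum_distrib_left mult_ac)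
  qed
  have e1: "(\<Sum>k<K1. ennreal (\<pi>1 k) * ennreal (2 * trace (\<Sigma>1 k))) = ennreal T1"
  proof -
    have "(\<Sum>k<K1. ennreal (\<pi>1 k) * ennreal (2 * trace (\<Sigma>1 k))) = (\<Sum>k<K1. ennreal (\<pi>1 k * (2 * trace (\<Sigma>1 k))))"
      using 1(3) t1 by (intro sum.cong refl) (simp add: ennreal_mult)
    also have "\<dots> = ennreal (\<Sum>k<K1. \<pi>1 k * (2 * trace (\<Sigma>1 k)))"
      using 1(3) t1 by (intro sum_ennreal) simp
    finally show ?thesis by (simp add: T1_def sum_distrib_left mult_ac)
  qed
  have T: "0 \<le> T0" "0 \<le> T1"
    unfolding T0_def T1_def using 0(3) 1(3) t0 t1 by (auto intro!: sum_nonneg)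
  have "MW2 \<mu>0 \<mu>1 \<le> W2 \<mu>0 \<mu>1 + (sqrt T0 + sqrt T1)"
  proof (rule field_le_epsilon)
    fix e :: real assume "e > 0"
    \<comment> \<open>A slack \<open>e\<close> yields a coupling of cost below \<open>x\<^sup>2\<close>, so no optimal coupling has to exist.\<close>
    define x where "x = W2 \<mu>0 \<mu>1 + e"
    have x: "x > 0" "W2 \<mu>0 \<mu>1 < x" using \<open>e > 0\<close> W(3) by (auto simp: x_def)
    have "(W2 \<mu>0 \<mu>1)\<^sup>2 < x\<^sup>2" using W(3) x by (intro power_strict_mono) auto
    then have "(INF \<gamma>\<in>couplings \<mu>0 \<mu>1. transport_cost \<gamma>) < ennreal (x\<^sup>2)"
      unfolding W(1)[symmetric] by (simp add: ennreal_less_iff)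
    then obtain \<gamma> where \<gamma>: "\<gamma> \<in> couplings \<mu>0 \<mu>1" "transport_cost \<gamma> < ennreal (x\<^sup>2)"
      by (auto simp: INF_less_iff)
    obtain \<gamma>' where \<gamma>': "\<gamma>' \<in> couplings \<mu>0 \<mu>1 \<inter> GMM_fin"
      and bound: "\<forall>a b c::real. 0 < a \<and> 0 < b \<and> 0 < c \<and> a + b + c = 1 \<longrightarrow>
        transport_cost \<gamma>' \<le> ennreal (1 / a) * transport_cost \<gamma>
        + ennreal (1 / b) * ennreal T0 + ennreal (1 / c) * ennreal T1"
      using GMM_coupling_near_coupling[OF \<gamma>(1) 0(1,2) 1(1) g0 g1, folded trace_eq_sum_Basis, unfolded e0 e1]
      by (rule bexE)
    have "(MW2 \<mu>0 \<mu>1)\<^sup>2 \<le> x\<^sup>2 / a + (sqrt T0)\<^sup>2 / b + (sqrt T1)\<^sup>2 / c"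
      if abc: "0 < a" "0 < b" "0 < c" "a + b + c = 1" for a b c
    proof -
      have "ennreal ((MW2 \<mu>0 \<mu>1)\<^sup>2) \<le> transport_cost \<gamma>'"
        unfolding W(2) using \<gamma>' by (intro INF_lower) auto
      also have "\<dots> \<le> ennreal (1 / a) * transport_cost \<gamma> + ennreal (1 / b) * ennreal T0 + ennreal (1 / c) * ennreal T1"
        using bound abc by simp
      also have "ennreal (1 / a) * transport_cost \<gamma> + ennreal (1 / b) * ennreal T0 + ennreal (1 / c) * ennreal T1
          \<le> ennreal (1 / a) * ennreal (x\<^sup>2) + ennreal (1 / b) * ennreal T0 + ennreal (1 / c) * ennreal T1"
        using \<gamma>(2) by (intro add_mono mult_left_mono) auto
      also have "\<dots> = ennreal (x\<^sup>2 / a + (sqrt T0)\<^sup>2 / b + (sqrt T1)\<^sup>2 / c)"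
        using abc T by (simp add: ennreal_mult[symmetric] ennreal_plus[symmetric] del: ennreal_plus)
      finally show ?thesis using abc by (subst (asm) ennreal_le_iff) auto
    qed
    then have "sqrt ((MW2 \<mu>0 \<mu>1)\<^sup>2) \<le> x + sqrt T0 + sqrt T1"
      using x T by (intro sqrt_le_of_weighted_bounds) auto
    then show "MW2 \<mu>0 \<mu>1 \<le> W2 \<mu>0 \<mu>1 + (sqrt T0 + sqrt T1) + e"
      using W(4) by (simp add: x_def)
  qed
  then show ?thesis by (simp only: T0_def T1_def)
qed

section \<open>Equality for two Gaussians\<close>

lemma coupling_has_mean_cov:
  fixes \<mu>0 \<mu>1 :: "'a::euclidean_space measure"
  assumes \<gamma>: "\<gamma> \<in> couplings \<mu>0 \<mu>1" and mc0: "has_mean_cov \<mu>0 m0 S0" and mc1: "has_mean_cov \<mu>1 m1 S1"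
  obtains S where "has_mean_cov \<gamma> (m0, m1) S" "linear S" "\<And>u v. S u \<bullet> v = u \<bullet> S v" "\<And>u. 0 \<le> u \<bullet> S u"
proof -
  have s[measurable_cong]: "sets \<gamma> = sets borel" and pg: "prob_space \<gamma>"
    and d0: "distr \<gamma> borel fst = \<mu>0" and d1: "distr \<gamma> borel snd = \<mu>1"
    using \<gamma> by (auto simp: couplings_def)
  interpret prob_space \<gamma> by (rule pg)
  have m: "fst \<in> measurable \<gamma> borel" "snd \<in> measurable \<gamma> borel" by simp_all
  define q where "q p = p - (m0, m1)" for p
  have [measurable]: "q \<in> borel_measurable \<gamma>" unfolding q_def by measurable
  have split: "q p \<bullet> u = (fst p - m0) \<bullet> fst u + (snd p - m1) \<bullet> snd u" for p u
    by (cases p; cases u) (simp add: q_def)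
  have i0: "integrable \<gamma> (\<lambda>p. (fst p - m0) \<bullet> a)" "(\<integral>p. (fst p - m0) \<bullet> a \<partial>\<gamma>) = 0"
    "integrable \<gamma> (\<lambda>p. ((fst p - m0) \<bullet> a)\<^sup>2)" for a
    using has_mean_covD(3-5)[OF mc0, of a] m unfolding d0[symmetric]
    by (simp_all add: integrable_distr_eq integral_distr)
  have i1: "integrable \<gamma> (\<lambda>p. (snd p - m1) \<bullet> a)" "(\<integral>p. (snd p - m1) \<bullet> a \<partial>\<gamma>) = 0"
    "integrable \<gamma> (\<lambda>p. ((snd p - m1) \<bullet> a)\<^sup>2)" for a
    using has_mean_covD(3-5)[OF mc1, of a] m unfolding d1[symmetric]
    by (simp_all add: integrable_distr_eq integral_distr)
  have iq: "integrable \<gamma> (\<lambda>p. q p \<bullet> u)" "(\<integral>p. q p \<bullet> u \<partial>\<gamma>) = 0" for u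
    unfolding split using i0 i1 by simp_all
  have iq2: "integrable \<gamma> (\<lambda>p. (q p \<bullet> u)\<^sup>2)" for u
  proof (rule Bochner_Integration.integrable_bound)
    show "integrable \<gamma> (\<lambda>p. 2 * ((fst p - m0) \<bullet> fst u)\<^sup>2 + 2 * ((snd p - m1) \<bullet> snd u)\<^sup>2)"
      using i0 i1 by simp
    have "(x + y)\<^sup>2 \<le> 2 * x\<^sup>2 + 2 * y\<^sup>2" for x y :: real
      using sum_squares_bound[of x y] by (simp add: power2_sum)
    then show "AE p in \<gamma>. norm ((q p \<bullet> u)\<^sup>2) \<le> norm (2 * ((fst p - m0) \<bullet> fst u)\<^sup>2 + 2 * ((snd p - m1) \<bullet> snd u)\<^sup>2)"
      unfolding split by (intro AE_I2) simp
  qed measurable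
  have iqq: "integrable \<gamma> (\<lambda>p. (q p \<bullet> u) * (q p \<bullet> v))" for u v
  proof -
    have eq: "(q p \<bullet> u) * (q p \<bullet> v) = ((q p \<bullet> (u + v))\<^sup>2 - (q p \<bullet> u)\<^sup>2 - (q p \<bullet> v)\<^sup>2) / 2" for p
      by (simp add: inner_add_right power2_sum)
    show ?thesis unfolding eq by (simp add: iq2)
  qed
  \<comment> \<open>The mixed second moments exist by polarisation; \<open>S\<close> is the operator with this bilinear form.\<close>
  define S where "S u = (\<Sum>e\<in>Basis. (\<integral>p. (q p \<bullet> u) * (q p \<bullet> e) \<partial>\<gamma>) *\<^sub>R e)" for u
  have SQ: "S u \<bullet> v = (\<integral>p. (q p \<bullet> u) * (q p \<bullet> v) \<partial>\<gamma>)" for u v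
  proof -
    have "S u \<bullet> v = (\<integral>p. (\<Sum>e\<in>Basis. (q p \<bullet> u) * (q p \<bullet> e) * (e \<bullet> v)) \<partial>\<gamma>)"
      unfolding S_def inner_sum_left inner_scaleR_left using iqq
      by (subst Bochner_Integration.integral_sum) auto
    also have "(\<lambda>p. \<Sum>e\<in>Basis. (q p \<bullet> u) * (q p \<bullet> e) * (e \<bullet> v)) = (\<lambda>p. (q p \<bullet> u) * (q p \<bullet> v))"
      by (subst (3) euclidean_inner) (simp add: sum_distrib_left inner_commute mult.assoc)
    finally show ?thesis .
  qed
  show ?thesis
  proof (rule that[of S])
    have "u \<bullet> S u = (\<integral>p. (q p \<bullet> u)\<^sup>2 \<partial>\<gamma>)" for u
      by (simp add: inner_commute[of u] SQ power2_eq_square)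
    then show "has_mean_cov \<gamma> (m0, m1) S" and "\<And>u. 0 \<le> u \<bullet> S u"
      using s pg iq iq2 unfolding has_mean_cov_def q_def[symmetric] by simp_all
    show "S u \<bullet> v = u \<bullet> S v" for u v
      by (simp add: inner_commute[of u] SQ mult.commute)
    show "linear S"
      by (rule linearI; rule vector_eq_rdot[THEN iffD1]; intro allI)
        (simp_all add: inner_add_left SQ inner_add_right distrib_right iqq mult.assoc)
  qed
qed

text \<open>The squared distance is a sum of squares of linear functionals \<open>p \<bullet> (e, - e)\<close>, so the cost
  depends on the mean and the covariance only.\<close>

lemma has_mean_cov_transport_cost:
  fixes \<gamma> :: "('a::euclidean_space \<times> 'a) measure"
  assumes "has_mean_cov \<gamma> m S"
  shows "transport_cost \<gamma> = ennreal (\<Sum>e\<in>Basis. (m \<bullet> (e, - e))\<^sup>2 + (e, - e) \<bullet> S (e, - e))"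
proof -
  have [measurable_cong]: "sets \<gamma> = sets borel" using assms by (rule has_mean_covD)
  have "transport_cost \<gamma> = (\<integral>\<^sup>+p. (\<Sum>e\<in>Basis. ennreal (((p - 0) \<bullet> (e, - e))\<^sup>2)) \<partial>\<gamma>)"
    unfolding transport_cost_def
    by (intro nn_integral_cong) (auto simp: norm_square_eq_sum_Basis sum_ennreal inner_diff_left)
  also have "\<dots> = (\<Sum>e\<in>Basis. \<integral>\<^sup>+p. ennreal (((p - 0) \<bullet> (e, - e))\<^sup>2) \<partial>\<gamma>)"
    by (rule nn_integral_sum) measurable
  also have "\<dots> = (\<Sum>e\<in>Basis. ennreal (((m - 0) \<bullet> (e, - e))\<^sup>2 + (e, - e) \<bullet> S (e, - e)))"
    by (simp only: has_mean_cov_second_moment[OF assms])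
  also have "\<dots> = ennreal (\<Sum>e\<in>Basis. (m \<bullet> (e, - e))\<^sup>2 + (e, - e) \<bullet> S (e, - e))"
    using has_mean_cov_second_moment(2)[OF assms] by (simp add: sum_ennreal del: ennreal_plus)
  finally show ?thesis .
qed

text \<open>The Gaussian with the mean and the covariance of \<open>\<gamma>\<close>. Its marginals are Gaussian with the
  right means and covariances, hence they are the given ones.\<close>

lemma gaussian_coupling_of_same_cost:
  fixes \<mu>0 \<mu>1 :: "'a::euclidean_space measure"
  assumes \<gamma>: "\<gamma> \<in> couplings \<mu>0 \<mu>1" and g0: "is_gaussian \<mu>0 m0 S0" and g1: "is_gaussian \<mu>1 m1 S1"
  obtains \<gamma>' m S where "\<gamma>' \<in> couplings \<mu>0 \<mu>1" "is_gaussian \<gamma>' m S" "transport_cost \<gamma>' = transport_cost \<gamma>"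
proof -
  have s[measurable_cong]: "sets \<gamma> = sets borel"
    and d0: "distr \<gamma> borel fst = \<mu>0" and d1: "distr \<gamma> borel snd = \<mu>1"
    using \<gamma> by (auto simp: couplings_def)
  obtain S where mc: "has_mean_cov \<gamma> (m0, m1) S" and S: "linear S" "\<And>u v. S u \<bullet> v = u \<bullet> S v" "\<And>u. 0 \<le> u \<bullet> S u"
    using coupling_has_mean_cov[OF \<gamma> is_gaussian_has_mean_cov[OF g0] is_gaussian_has_mean_cov[OF g1]] by blast
  obtain A :: "'a \<times> 'a \<Rightarrow> 'a \<times> 'a" where A: "linear A" and SA: "S = A \<circ> adjoint A"
    using psd_operator_factor[OF S] by blast
  have [measurable]: "A \<in> borel_measurable borel" using A by (rule borel_measurable_linear)
  define G where "G = distr std_gaussian borel (\<lambda>z. (m0, m1) + A z)"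
  have gG: "is_gaussian G (m0, m1) S" unfolding G_def SA using A by (rule is_gaussianI)
  have mcG: "has_mean_cov G (m0, m1) S" using gG by (rule is_gaussian_has_mean_cov)
  have sG[measurable_cong]: "sets G = sets borel" by (simp add: G_def)
  \<comment> \<open>Testing the second moments on \<open>(u, 0)\<close> and \<open>(0, u)\<close> recovers those of the marginals.\<close>
  have mom: "(\<integral>p. ((p - (m0, m1)) \<bullet> u)\<^sup>2 \<partial>G) = (\<integral>p. ((p - (m0, m1)) \<bullet> u)\<^sup>2 \<partial>\<gamma>)" for u
    by (simp only: has_mean_covD(6)[OF mc] has_mean_covD(6)[OF mcG])
  have G0: "distr G borel fst = distr std_gaussian borel (\<lambda>z. m0 + (fst \<circ> A) z)"
    unfolding G_def by (subst distr_distr) (auto simp: o_def)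
  have "distr std_gaussian borel (\<lambda>z. m0 + (fst \<circ> A) z) = \<mu>0"
  proof (rule gaussian_eq_of_second_moments[OF g0])
    show "linear (fst \<circ> A)" by (rule linear_compose[OF A linear_fst])
    show "(\<integral>x. ((x - m0) \<bullet> u)\<^sup>2 \<partial>distr std_gaussian borel (\<lambda>z. m0 + (fst \<circ> A) z)) = (\<integral>x. ((x - m0) \<bullet> u)\<^sup>2 \<partial>\<mu>0)" for u
      unfolding G0[symmetric] d0[symmetric] using mom[of "(u, 0)"]
      by (simp add: integral_distr inner_prod_def)
  qed
  with G0 have 0: "distr G borel fst = \<mu>0" by simp
  have G1: "distr G borel snd = distr std_gaussian borel (\<lambda>z. m1 + (snd \<circ> A) z)"
    unfolding G_def by (subst distr_distr) (auto simp: o_def)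
  have "distr std_gaussian borel (\<lambda>z. m1 + (snd \<circ> A) z) = \<mu>1"
  proof (rule gaussian_eq_of_second_moments[OF g1])
    show "linear (snd \<circ> A)" by (rule linear_compose[OF A linear_snd])
    show "(\<integral>x. ((x - m1) \<bullet> u)\<^sup>2 \<partial>distr std_gaussian borel (\<lambda>z. m1 + (snd \<circ> A) z)) = (\<integral>x. ((x - m1) \<bullet> u)\<^sup>2 \<partial>\<mu>1)" for u
      unfolding G1[symmetric] d1[symmetric] using mom[of "(0, u)"]
      by (simp add: integral_distr inner_prod_def)
  qed
  with G1 have 1: "distr G borel snd = \<mu>1" by simp
  show ?thesis
  proof (rule that[OF _ gG])
    show "G \<in> couplings \<mu>0 \<mu>1"
      using has_mean_covD(1)[OF mcG] sG 0 1 by (simp add: couplings_def)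
    show "transport_cost G = transport_cost \<gamma>"
      by (simp only: has_mean_cov_transport_cost[OF mc] has_mean_cov_transport_cost[OF mcG])
  qed
qed

lemma mixture_of_singleton:
  assumes "sets \<mu> = sets borel"
  shows "mixture_of \<mu> {()} (\<lambda>_. 1) (\<lambda>_. \<mu>)"
  using assms by (simp add: mixture_of_def)

lemma is_gaussian_in_GMM_fin:
  fixes \<mu> :: "'a::euclidean_space measure"
  assumes "is_gaussian \<mu> m S"
  shows "\<mu> \<in> GMM_fin"
  using assms has_mean_covD(2)[OF is_gaussian_has_mean_cov[OF assms]]
  by (intro GMM_finI[OF mixture_of_singleton]) auto

lemma GMM_1_is_gaussian:
  fixes \<mu> :: "'a::euclidean_space measure"
  assumes "\<mu> \<in> GMM 1"
  shows "\<exists>m S. is_gaussian \<mu> m S"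
proof -
  obtain \<pi> m S where "is_gaussian_mixture \<mu> 1 \<pi> m S" using assms by (auto simp: GMM_def)
  then obtain \<nu> where \<nu>: "mixture_of \<mu> {..<1::nat} (\<lambda>k. ennreal (\<pi> k)) \<nu>" "(\<Sum>k<1::nat. ennreal (\<pi> k)) = 1"
      "is_gaussian (\<nu> 0) (m 0) (S 0)"
    using is_gaussian_mixture_mixture_of by (metis less_one)
  have "\<mu> = \<nu> 0"
    using \<nu>(1,2) by (intro measure_eqI) (auto simp: mixture_of_def)
  then show ?thesis using \<nu>(3) by blast
qed

lemma W2_eq_MW2_gaussian:
  fixes \<mu>0 \<mu>1 :: "'a::euclidean_space measure"
  assumes "\<mu>0 \<in> GMM 1" "\<mu>1 \<in> GMM 1"
  shows "W2 \<mu>0 \<mu>1 = MW2 \<mu>0 \<mu>1"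
proof (rule W2_eq_MW2I)
  show "\<mu>0 \<in> GMM_fin" "\<mu>1 \<in> GMM_fin" using assms by (auto simp: GMM_fin_def)
  obtain m0 S0 m1 S1 where g: "is_gaussian \<mu>0 m0 S0" "is_gaussian \<mu>1 m1 S1"
    using assms[THEN GMM_1_is_gaussian] by blast
  fix \<gamma> assume \<gamma>: "\<gamma> \<in> couplings \<mu>0 \<mu>1"
  show "\<exists>\<gamma>'\<in>couplings \<mu>0 \<mu>1 \<inter> GMM_fin. transport_cost \<gamma>' \<le> transport_cost \<gamma>"
  proof (rule gaussian_coupling_of_same_cost[OF \<gamma> g])
    fix \<gamma>' m S
    assume "\<gamma>' \<in> couplings \<mu>0 \<mu>1" "is_gaussian \<gamma>' m S" "transport_cost \<gamma>' = transport_cost \<gamma>"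
    then show ?thesis using is_gaussian_in_GMM_fin by (intro bexI[of _ \<gamma>']) auto
  qed
qed

section \<open>Equality for finitely supported measures\<close>

lemma is_gaussian_return:
  "is_gaussian (return borel m) m (\<lambda>_. 0)" for m :: "'a::euclidean_space"
proof -
  interpret prob_space "std_gaussian :: 'a measure" by (rule prob_space_std_gaussian)
  have "adjoint (\<lambda>_::'a. 0::'a) = (\<lambda>_. 0)" by (rule adjoint_unique) simp
  then show ?thesis using is_gaussianI[of "\<lambda>_::'a. 0" m] by (simp add: linear_zero o_def)
qed

lemma finite_support_mixture_of_return:
  fixes \<mu> :: "'a::euclidean_space measure"
  assumes s: "sets \<mu> = sets borel" and Z: "finite Z" "AE x in \<mu>. x \<in> Z"
  shows "mixture_of \<mu> Z (\<lambda>x. emeasure \<mu> {x}) (return borel)"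
proof -
  have "emeasure \<mu> B = (\<Sum>x\<in>Z. emeasure \<mu> {x} * emeasure (return borel x) B)" if B: "B \<in> sets borel" for B
  proof -
    have Zb: "Z \<in> sets borel" using Z(1) by (intro borel_closed finite_imp_closed)
    have "emeasure \<mu> B = emeasure \<mu> (B \<inter> Z)"
      using Z(2) B Zb s by (intro emeasure_eq_AE) auto
    also have "\<dots> = (\<Sum>x\<in>B \<inter> Z. emeasure \<mu> {x})"
      using Z(1) s by (intro emeasure_eq_sum_singleton) auto
    also have "\<dots> = (\<Sum>x\<in>Z. emeasure \<mu> {x} * indicator B x)"
      using Z(1) by (intro sum.mono_neutral_cong_left) (auto simp: indicator_def)
    finally show ?thesis using B by simp
  qed
  then show ?thesis using s Z(1) unfolding mixture_of_def by (intro conjI ballI sets_return)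
qed

lemma finite_support_GMM_fin:
  fixes \<mu> :: "'a::euclidean_space measure"
  assumes "prob_space \<mu>" "sets \<mu> = sets borel" "finite Z" "AE x in \<mu>. x \<in> Z"
  shows "\<mu> \<in> GMM_fin"
proof (rule GMM_finI)
  interpret prob_space \<mu> by fact
  show mix: "mixture_of \<mu> Z (\<lambda>x. emeasure \<mu> {x}) (return borel)"
    by (rule finite_support_mixture_of_return) fact+
  have "emeasure \<mu> UNIV = (\<Sum>x\<in>Z. emeasure \<mu> {x})"
    using mixture_ofD(6)[OF mix, of UNIV] by simp
  then show "(\<Sum>x\<in>Z. emeasure \<mu> {x}) = 1"
    using emeasure_space_1 mixture_ofD(3)[OF mix] by simp
  show "\<exists>m S. is_gaussian (return borel x) m S" for x :: 'a using is_gaussian_return by blast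
qed

text \<open>The coefficients may have any sign, but the set \<open>X\<close> of atoms receives the same mass as the whole space.\<close>

lemma dirac_combination_finite_support:
  fixes \<mu> :: "'a::euclidean_space measure"
  assumes "prob_space \<mu>" "dirac_combination \<mu>"
  shows "\<exists>Z. finite Z \<and> (AE x in \<mu>. x \<in> Z)"
proof -
  interpret prob_space \<mu> by fact
  obtain X c where s: "sets \<mu> = sets borel" and X: "finite X"
    and c: "\<And>B. B \<in> sets borel \<Longrightarrow> measure \<mu> B = (\<Sum>x\<in>X. c x * indicator B x)"
    using assms(2) unfolding dirac_combination_def by metis
  have Xb: "X \<in> sets borel" using X by (intro borel_closed finite_imp_closed)
  have sp: "space \<mu> = UNIV" using sets_eq_imp_space_eq[OF s] by simp
  have "prob X = prob UNIV" using c[OF Xb] c[of UNIV] by simp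
  then have "prob X = 1" using prob_space sp by simp
  then have "AE x in \<mu>. x \<in> X" using Xb s by (intro AE_prob_1) auto
  with X show ?thesis by blast
qed

text \<open>A coupling of two finitely supported measures is finitely supported, thus itself a mixture of
  degenerate Gaussians: the two infima range over the same couplings.\<close>

lemma W2_eq_MW2_dirac:
  fixes \<mu>0 \<mu>1 :: "'a::euclidean_space measure"
  assumes G: "\<mu>0 \<in> GMM_fin" "\<mu>1 \<in> GMM_fin" and d: "dirac_combination \<mu>0" "dirac_combination \<mu>1"
  shows "W2 \<mu>0 \<mu>1 = MW2 \<mu>0 \<mu>1"
proof (rule W2_eq_MW2I[OF G])
  obtain X where X: "finite X" "AE x in \<mu>0. x \<in> X"
    using dirac_combination_finite_support[OF GMM_fin_prob_space[OF G(1)] d(1)] by blast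
  obtain Y where Y: "finite Y" "AE y in \<mu>1. y \<in> Y"
    using dirac_combination_finite_support[OF GMM_fin_prob_space[OF G(2)] d(2)] by blast
  fix \<gamma> assume \<gamma>: "\<gamma> \<in> couplings \<mu>0 \<mu>1"
  then have s[measurable_cong]: "sets \<gamma> = sets borel" and pg: "prob_space \<gamma>"
    and d0: "distr \<gamma> borel fst = \<mu>0" and d1: "distr \<gamma> borel snd = \<mu>1"
    by (auto simp: couplings_def)
  have m: "fst \<in> measurable \<gamma> borel" "snd \<in> measurable \<gamma> borel" by simp_all
  have "AE p in \<gamma>. fst p \<in> X" using X(2) unfolding d0[symmetric] by (rule AE_distrD[OF m(1)])
  moreover have "AE p in \<gamma>. snd p \<in> Y" using Y(2) unfolding d1[symmetric] by (rule AE_distrD[OF m(2)])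
  ultimately have "AE p in \<gamma>. p \<in> X \<times> Y" by eventually_elim (simp add: mem_Times_iff)
  then have "\<gamma> \<in> GMM_fin" using pg s X Y by (intro finite_support_GMM_fin[of _ "X \<times> Y"]) auto
  with \<gamma> show "\<exists>\<gamma>'\<in>couplings \<mu>0 \<mu>1 \<inter> GMM_fin. transport_cost \<gamma>' \<le> transport_cost \<gamma>" by blast
qed

section \<open>Equality for affine maps\<close>

lemma affine_graph_gaussian:
  fixes \<nu> :: "'a::euclidean_space measure" and A :: "'a \<Rightarrow> 'a"
  assumes "is_gaussian \<nu> m S" and A: "linear A"
  shows "\<exists>m S. is_gaussian (distr \<nu> borel (\<lambda>x. (x, A x + b))) m S"
proof -
  obtain L :: "'a \<Rightarrow> 'a" where L: "linear L" "S = L \<circ> adjoint L" "\<nu> = distr std_gaussian borel (\<lambda>z. m + L z)"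
    using assms(1) by (rule is_gaussianE)
  have [measurable]: "L \<in> borel_measurable borel" "A \<in> borel_measurable borel"
    using L(1) A by (auto intro: borel_measurable_linear)
  \<comment> \<open>A Gaussian on the product space is driven by noise on that space; the first noise coordinate has the law of the noise behind \<open>\<nu>\<close>.\<close>
  define C where "C p = (L (fst p), A (L (fst p)))" for p :: "'a \<times> 'a"
  have C: "linear C"
    by (rule linearI) (simp_all add: C_def linear_add linear_scale L(1) A)
  have "distr \<nu> borel (\<lambda>x. (x, A x + b))
      = distr std_gaussian borel (\<lambda>z. (m + L z, A (m + L z) + b))"
    unfolding L(3) by (subst distr_distr) (auto simp: o_def)
  also have "\<dots> = distr (distr std_gaussian borel (fst :: 'a \<times> 'a \<Rightarrow> 'a)) borel (\<lambda>z. (m + L z, A (m + L z) + b))"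
    by (simp only: std_gaussian_marginals)
  also have "\<dots> = distr std_gaussian borel (\<lambda>p. (m, A m + b) + C p)"
    by (subst distr_distr) (auto simp: o_def C_def linear_add[OF A] add_ac)
  finally show ?thesis using is_gaussianI[OF C, of "(m, A m + b)"] by auto
qed

lemma affine_plan:
  fixes \<mu>0 :: "'a::euclidean_space measure" and A :: "'a \<Rightarrow> 'a"
  assumes G: "\<mu>0 \<in> GMM_fin" and A: "linear A"
  shows "distr \<mu>0 borel (\<lambda>x. (x, A x + b)) \<in> couplings \<mu>0 (distr \<mu>0 borel (\<lambda>x. A x + b)) \<inter> GMM_fin"
proof
  interpret prob_space \<mu>0 using G by (rule GMM_fin_prob_space)
  have [measurable_cong]: "sets \<mu>0 = sets borel" using G by (rule GMM_fin_sets)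
  have [measurable]: "A \<in> borel_measurable borel" using A by (rule borel_measurable_linear)
  have "distr \<mu>0 borel (\<lambda>x. x) = \<mu>0" by (rule distr_id2) (rule GMM_fin_sets[OF G, symmetric])
  then show "distr \<mu>0 borel (\<lambda>x. (x, A x + b)) \<in> couplings \<mu>0 (distr \<mu>0 borel (\<lambda>x. A x + b))"
    unfolding couplings_def by (auto simp: distr_distr o_def intro!: prob_space_distr)
  obtain K :: nat and c \<nu> where mix: "mixture_of \<mu>0 {..<K} c \<nu>" "(\<Sum>k<K. c k) = 1"
    and g: "\<And>k. k < K \<Longrightarrow> \<exists>m S. is_gaussian (\<nu> k) m S"
    using GMM_finE[OF G] by metis
  show "distr \<mu>0 borel (\<lambda>x. (x, A x + b)) \<in> GMM_fin"
  proof (rule GMM_finI[OF mixture_of_distr[OF mix(1)] mix(2)])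
    show "\<exists>m S. is_gaussian (distr (\<nu> k) borel (\<lambda>x. (x, A x + b))) m S" if "k \<in> {..<K}" for k
      using g[of k] that affine_graph_gaussian[OF _ A] by blast
  qed simp
qed

lemma W2_eq_MW2_affine_plan:
  fixes \<mu>0 \<mu>1 :: "'a::euclidean_space measure" and A :: "'a \<Rightarrow> 'a"
  assumes G: "\<mu>0 \<in> GMM_fin" "\<mu>1 \<in> GMM_fin" and A: "linear A" and \<mu>1: "distr \<mu>0 borel (\<lambda>x. A x + b) = \<mu>1"
    and opt: "\<And>\<gamma>. \<gamma> \<in> couplings \<mu>0 \<mu>1 \<Longrightarrow> transport_cost (distr \<mu>0 borel (\<lambda>x. (x, A x + b))) \<le> transport_cost \<gamma>"
  shows "W2 \<mu>0 \<mu>1 = MW2 \<mu>0 \<mu>1"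
  using affine_plan[OF G(1) A, of b] opt unfolding \<mu>1 by (intro W2_eq_MW2I[OF G]) blast

lemma integrable_of_quadratic_bound:
  fixes \<mu> :: "'a::euclidean_space measure" and f :: "'a \<Rightarrow> real"
  assumes "prob_space \<mu>" and s[measurable_cong]: "sets \<mu> = sets borel"
    and fin: "(\<integral>\<^sup>+x. ennreal ((norm x)\<^sup>2) \<partial>\<mu>) < \<infinity>"
    and f: "f \<in> borel_measurable borel" and bound: "\<And>x. \<bar>f x\<bar> \<le> K * (1 + (norm x)\<^sup>2)"
  shows "integrable \<mu> f"
proof (rule Bochner_Integration.integrable_bound)
  interpret prob_space \<mu> by fact
  have "integrable \<mu> (\<lambda>x. (norm x)\<^sup>2)"
    using fin by (intro integrableI_bounded) simp_all
  then show "integrable \<mu> (\<lambda>x. K * (1 + (norm x)\<^sup>2))" by simp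
  show "AE x in \<mu>. norm (f x) \<le> norm (K * (1 + (norm x)\<^sup>2))"
    using bound by (intro AE_I2) (metis abs_ge_self order_trans real_norm_def)
qed (use f in measurable)

text \<open>The map is the gradient of a convex quadratic function, so Kantorovich duality applies with explicit
  potentials: \<open>u x + v y \<le> (norm (x - y))\<^sup>2\<close> almost everywhere, with equality on the graph.\<close>

lemma psd_affine_plan_optimal:
  fixes \<mu>0 \<mu>1 :: "'a::euclidean_space measure" and A :: "'a \<Rightarrow> 'a"
  assumes \<mu>0: "prob_space \<mu>0" "sets \<mu>0 = sets borel"
    and fin: "(\<integral>\<^sup>+x. ennreal ((norm x)\<^sup>2) \<partial>\<mu>0) < \<infinity>" "(\<integral>\<^sup>+x. ennreal ((norm x)\<^sup>2) \<partial>\<mu>1) < \<infinity>"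
    and A: "linear A" and sym: "\<And>x y. A x \<bullet> y = x \<bullet> A y" and pos: "\<And>x. 0 \<le> x \<bullet> A x"
    and \<mu>1: "distr \<mu>0 borel (\<lambda>x. A x + b) = \<mu>1" and \<gamma>: "\<gamma> \<in> couplings \<mu>0 \<mu>1"
  shows "transport_cost (distr \<mu>0 borel (\<lambda>x. (x, A x + b))) \<le> transport_cost \<gamma>"
proof -
  have s[measurable_cong]: "sets \<gamma> = sets borel" and pg: "prob_space \<gamma>"
    and d0: "distr \<gamma> borel fst = \<mu>0" and d1: "distr \<gamma> borel snd = \<mu>1"
    using \<gamma> by (auto simp: couplings_def)
  interpret G: prob_space \<gamma> by (rule pg)
  interpret M: prob_space \<mu>0 by (rule \<mu>0)
  note [measurable_cong] = \<mu>0(2)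
  have m: "fst \<in> measurable \<gamma> borel" "snd \<in> measurable \<gamma> borel" by simp_all
  have [measurable]: "A \<in> borel_measurable borel" using A by (rule borel_measurable_linear)
  have p1: "prob_space \<mu>1" and s1: "sets \<mu>1 = sets borel"
    unfolding \<mu>1[symmetric] by (auto intro!: M.prob_space_distr)
  \<comment> \<open>\<open>g\<close> is a linear generalised inverse of \<open>A\<close>; it replaces the inverse when \<open>A\<close> is singular.\<close>
  obtain g where g: "linear g" and AgA: "\<And>x. A (g (A x)) = A x"
    using linear_exists_right_inverse_on[OF A subspace_UNIV] by auto
  have [measurable]: "g \<in> borel_measurable borel" using g by (rule borel_measurable_linear)
  \<comment> \<open>\<open>u\<close> and \<open>v\<close> are the Kantorovich potentials of the cost \<open>(norm (x - y))\<^sup>2\<close> built from the convex potential \<open>x \<bullet> A x / 2 + x \<bullet> b\<close> and its conjugate, the latter only where it is finite.\<close>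
  define u where "u x = (norm x)\<^sup>2 - x \<bullet> A x - 2 * (x \<bullet> b)" for x
  define v where "v y = (norm y)\<^sup>2 - g (y - b) \<bullet> (y - b)" for y
  have [measurable]: "u \<in> borel_measurable borel" "v \<in> borel_measurable borel"
    unfolding u_def v_def by measurable
  have key: "(norm (x - y))\<^sup>2 - (u x + v y) = (x - g (y - b)) \<bullet> A (x - g (y - b))"
    if "A (g (y - b)) = y - b" for x y
  proof -
    define x' where "x' = g (y - b)"
    have y: "y = A x' + b" using that by (simp add: x'_def)
    have "(norm (x - y))\<^sup>2 = (norm x)\<^sup>2 + (norm y)\<^sup>2 - 2 * (x \<bullet> y)"
      by (simp add: power2_norm_eq_inner inner_diff_left inner_diff_right inner_commute)
    moreover have "v y = (norm y)\<^sup>2 - x' \<bullet> A x'"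
      using that by (simp add: v_def x'_def)
    moreover have "x \<bullet> y = x \<bullet> A x' + x \<bullet> b" by (simp add: y inner_add_right)
    moreover have "(x - x') \<bullet> A (x - x') = x \<bullet> A x + x' \<bullet> A x' - 2 * (x \<bullet> A x')"
      using sym[of x x'] by (simp add: linear_diff[OF A] inner_diff_left inner_diff_right inner_commute)
    ultimately show ?thesis by (simp add: u_def x'_def[symmetric])
  qed
  have le: "u x + v y \<le> (norm (x - y))\<^sup>2" if "A (g (y - b)) = y - b" for x y
    using key[OF that, of x] pos[of "x - g (y - b)"] by simp
  have eq: "u x + v (A x + b) = (norm (x - (A x + b)))\<^sup>2" for x
  proof -
    have "A (x - g (A x)) = 0" by (simp add: linear_diff[OF A] AgA)
    then show ?thesis using key[of "A x + b" x] by (simp add: AgA)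
  qed
  \<comment> \<open>Quadratic growth makes the potentials integrable.\<close>
  obtain KA where KA: "0 \<le> KA" "\<And>x. norm (A x) \<le> KA * norm x"
    using linear_bounded_pos[OF A] by (metis less_imp_le)
  obtain Kg where Kg: "0 \<le> Kg" "\<And>x. norm (g x) \<le> Kg * norm x"
    using linear_bounded_pos[OF g] by (metis less_imp_le)
  have quad: "\<bar>f x \<bullet> x\<bar> \<le> K * (norm x)\<^sup>2" if "norm (f x) \<le> K * norm x" for f :: "'a \<Rightarrow> 'a" and x K
  proof -
    have "\<bar>f x \<bullet> x\<bar> \<le> norm (f x) * norm x" by (rule Cauchy_Schwarz_ineq2)
    also have "\<dots> \<le> K * norm x * norm x" using that by (intro mult_right_mono) auto
    finally show ?thesis by (simp add: power2_eq_square mult.assoc)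
  qed
  have two: "2 * (norm x * norm z) \<le> (norm x)\<^sup>2 + (norm z)\<^sup>2" for x z :: 'a
    using sum_squares_bound[of "norm x" "norm z"] by simp
  have iu: "integrable \<mu>0 u"
  proof (rule integrable_of_quadratic_bound[OF \<mu>0 fin(1)])
    show "\<bar>u x\<bar> \<le> (2 + KA + (norm b)\<^sup>2) * (1 + (norm x)\<^sup>2)" for x
    proof -
      have "\<bar>x \<bullet> A x\<bar> \<le> KA * (norm x)\<^sup>2" using quad[of A x KA, OF KA(2)] by (simp add: inner_commute)
      moreover have "2 * \<bar>x \<bullet> b\<bar> \<le> (norm x)\<^sup>2 + (norm b)\<^sup>2"
        using Cauchy_Schwarz_ineq2[of x b] two[of x b] by linarith
      moreover have "\<bar>u x\<bar> \<le> (norm x)\<^sup>2 + \<bar>x \<bullet> A x\<bar> + 2 * \<bar>x \<bullet> b\<bar>"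
        unfolding u_def using zero_le_power2[of "norm x"] by linarith
      ultimately have "\<bar>u x\<bar> \<le> 2 * (norm x)\<^sup>2 + KA * (norm x)\<^sup>2 + (norm b)\<^sup>2" by linarith
      also have "\<dots> \<le> (2 + KA + (norm b)\<^sup>2) * (1 + (norm x)\<^sup>2)"
        using KA(1) by (simp add: algebra_simps)
      finally show ?thesis .
    qed
  qed measurable
  have iv: "integrable \<mu>1 v"
  proof (rule integrable_of_quadratic_bound[OF p1 s1 fin(2)])
    show "\<bar>v y\<bar> \<le> (1 + 2 * Kg + 2 * Kg * (norm b)\<^sup>2) * (1 + (norm y)\<^sup>2)" for y
    proof -
      have "(norm (y - b))\<^sup>2 \<le> (norm y + norm b)\<^sup>2"
        by (intro power_mono norm_triangle_ineq4) simp
      also have "\<dots> \<le> 2 * (norm y)\<^sup>2 + 2 * (norm b)\<^sup>2"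
        using two[of y b] by (simp add: power2_sum)
      finally have "Kg * (norm (y - b))\<^sup>2 \<le> Kg * (2 * (norm y)\<^sup>2 + 2 * (norm b)\<^sup>2)"
        using Kg(1) by (rule mult_left_mono)
      moreover have "\<bar>g (y - b) \<bullet> (y - b)\<bar> \<le> Kg * (norm (y - b))\<^sup>2" by (rule quad[of g "y - b" Kg, OF Kg(2)])
      moreover have "\<bar>v y\<bar> \<le> (norm y)\<^sup>2 + \<bar>g (y - b) \<bullet> (y - b)\<bar>"
        unfolding v_def using zero_le_power2[of "norm y"] by linarith
      ultimately have "\<bar>v y\<bar> \<le> (norm y)\<^sup>2 + Kg * (2 * (norm y)\<^sup>2 + 2 * (norm b)\<^sup>2)" by linarith
      also have "\<dots> \<le> (1 + 2 * Kg + 2 * Kg * (norm b)\<^sup>2) * (1 + (norm y)\<^sup>2)"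
        using Kg(1) by (simp add: algebra_simps)
      finally show ?thesis .
    qed
  qed measurable
  have iu': "integrable \<gamma> (\<lambda>p. u (fst p))" "(\<integral>p. u (fst p) \<partial>\<gamma>) = (\<integral>x. u x \<partial>\<mu>0)"
    using iu m unfolding d0[symmetric] by (simp_all add: integrable_distr_eq integral_distr)
  have iv': "integrable \<gamma> (\<lambda>p. v (snd p))" "(\<integral>p. v (snd p) \<partial>\<gamma>) = (\<integral>y. v y \<partial>\<mu>1)"
    using iv m unfolding d1[symmetric] by (simp_all add: integrable_distr_eq integral_distr)
  have iv'': "integrable \<mu>0 (\<lambda>x. v (A x + b))" "(\<integral>x. v (A x + b) \<partial>\<mu>0) = (\<integral>y. v y \<partial>\<mu>1)"
    using iv unfolding \<mu>1[symmetric] by (simp_all add: integrable_distr_eq integral_distr)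
  \<comment> \<open>The second marginal lives on the affine subspace \<open>b + range A\<close>, where the potentials satisfy the duality inequality.\<close>
  have range: "AE p in \<gamma>. A (g (snd p - b)) = snd p - b"
  proof (rule AE_distrD[OF m(2), of "\<lambda>y. A (g (y - b)) = y - b"])
    show "AE y in distr \<gamma> borel snd. A (g (y - b)) = y - b"
      unfolding d1 \<mu>1[symmetric] by (subst AE_distr_iff) (simp_all add: AgA)
  qed
  have "transport_cost (distr \<mu>0 borel (\<lambda>x. (x, A x + b))) = (\<integral>\<^sup>+x. ennreal (u x + v (A x + b)) \<partial>\<mu>0)"
    unfolding transport_cost_def by (subst nn_integral_distr) (simp_all add: eq)
  also have "\<dots> = ennreal (\<integral>x. u x + v (A x + b) \<partial>\<mu>0)"
  proof (rule nn_integral_eq_integral)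
    show "integrable \<mu>0 (\<lambda>x. u x + v (A x + b))"
      using iu iv''(1) by (rule Bochner_Integration.integrable_add)
  qed (simp add: eq)
  also have "(\<integral>x. u x + v (A x + b) \<partial>\<mu>0) = (\<integral>p. u (fst p) + v (snd p) \<partial>\<gamma>)"
    using iu iu' iv' iv'' by simp
  also have "ennreal \<dots> \<le> ennreal (\<integral>p. (norm (fst p - snd p))\<^sup>2 \<partial>\<gamma>)"
  proof (intro ennreal_leI integral_mono_AE)
    show "integrable \<gamma> (\<lambda>p. (norm (fst p - snd p))\<^sup>2)"
      using coupling_cost_finite[OF \<gamma> fin]
      by (intro integrableI_bounded) (simp_all add: transport_cost_def)
    show "AE p in \<gamma>. u (fst p) + v (snd p) \<le> (norm (fst p - snd p))\<^sup>2"
      using range by eventually_elim (rule le)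
  qed (use iu' iv' in simp)
  also have "\<dots> \<le> transport_cost \<gamma>"
    unfolding transport_cost_def
    using coupling_cost_finite[OF \<gamma> fin]
    by (subst nn_integral_eq_integral) (auto intro!: integrableI_bounded simp: transport_cost_def)
  finally show ?thesis .
qed

section \<open>Bounds and cases of equality\<close>

theorem proposition6:
  fixes \<mu>0 \<mu>1 :: "(real^'d) measure"
    and K0 K1 :: nat
    and \<pi>0 \<pi>1 :: "nat \<Rightarrow> real"
    and m0 m1 :: "nat \<Rightarrow> real^'d"
    and \<Sigma>0 \<Sigma>1 :: "nat \<Rightarrow> real^'d^'d"
  assumes "is_gaussian_mixture \<mu>0 K0 \<pi>0 m0 (\<lambda>k. (*v) (\<Sigma>0 k))"
    and "is_gaussian_mixture \<mu>1 K1 \<pi>1 m1 (\<lambda>k. (*v) (\<Sigma>1 k))"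
  shows "W2 \<mu>0 \<mu>1 \<le> MW2 \<mu>0 \<mu>1
    \<and> MW2 \<mu>0 \<mu>1 \<le> W2 \<mu>0 \<mu>1
         + (sqrt (2 * (\<Sum>k<K0. \<pi>0 k * trace (\<Sigma>0 k)))
          + sqrt (2 * (\<Sum>k<K1. \<pi>1 k * trace (\<Sigma>1 k))))
    \<and> (\<mu>0 \<in> GMM 1 \<and> \<mu>1 \<in> GMM 1 \<longrightarrow> W2 \<mu>0 \<mu>1 = MW2 \<mu>0 \<mu>1)
    \<and> (dirac_combination \<mu>0 \<and> dirac_combination \<mu>1 \<longrightarrow> W2 \<mu>0 \<mu>1 = MW2 \<mu>0 \<mu>1)
    \<and> (\<forall>A b. psd_matrix A \<and> \<mu>1 = distr \<mu>0 borel (\<lambda>x. A *v x + b) \<longrightarrow>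
          W2 \<mu>0 \<mu>1 = MW2 \<mu>0 \<mu>1)
    \<and> (\<forall>A b. optimal_transport_map (\<lambda>x. A *v x + b) \<mu>0 \<mu>1 \<longrightarrow>
          W2 \<mu>0 \<mu>1 = MW2 \<mu>0 \<mu>1)"
proof (intro conjI allI impI)
  have G: "\<mu>0 \<in> GMM_fin" "\<mu>1 \<in> GMM_fin" using assms by (auto simp: GMM_fin_def GMM_def)
  show "W2 \<mu>0 \<mu>1 \<le> MW2 \<mu>0 \<mu>1" using G by (rule W2_le_MW2)
  show "MW2 \<mu>0 \<mu>1 \<le> W2 \<mu>0 \<mu>1
         + (sqrt (2 * (\<Sum>k<K0. \<pi>0 k * trace (\<Sigma>0 k)))
          + sqrt (2 * (\<Sum>k<K1. \<pi>1 k * trace (\<Sigma>1 k))))"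
    using assms by (rule MW2_upper_bound)
  show "W2 \<mu>0 \<mu>1 = MW2 \<mu>0 \<mu>1" if "\<mu>0 \<in> GMM 1 \<and> \<mu>1 \<in> GMM 1"
    using that by (intro W2_eq_MW2_gaussian) auto
  show "W2 \<mu>0 \<mu>1 = MW2 \<mu>0 \<mu>1" if "dirac_combination \<mu>0 \<and> dirac_combination \<mu>1"
    using that by (intro W2_eq_MW2_dirac[OF G]) auto
  \<comment> \<open>An affine plan is a Gaussian mixture, so it only has to be optimal among all couplings.\<close>
  have lin: "linear ((*v) A)" for A :: "real^'d^'d" by (rule matrix_vector_mul_linear)
  show "W2 \<mu>0 \<mu>1 = MW2 \<mu>0 \<mu>1" if "psd_matrix A \<and> \<mu>1 = distr \<mu>0 borel (\<lambda>x. A *v x + b)" for A b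
  proof (rule W2_eq_MW2_affine_plan[OF G lin])
    show \<mu>1: "distr \<mu>0 borel (\<lambda>x. A *v x + b) = \<mu>1" using that by simp
    have pos: "0 \<le> x \<bullet> (A *v x)" for x using that by (auto simp: psd_matrix_def)
    have sym: "(A *v x) \<bullet> y = x \<bullet> (A *v y)" for x y
      using that by (metis psd_matrix_def dot_lmul_matrix vector_transpose_matrix)
    show "transport_cost (distr \<mu>0 borel (\<lambda>x. (x, A *v x + b))) \<le> transport_cost \<gamma>"
      if "\<gamma> \<in> couplings \<mu>0 \<mu>1" for \<gamma>
      by (rule psd_affine_plan_optimal[OF GMM_fin_prob_space[OF G(1)] GMM_fin_sets[OF G(1)]
            GMM_fin_second_moment[OF G(1)] GMM_fin_second_moment[OF G(2)] lin sym pos \<mu>1 that])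
  qed
  show "W2 \<mu>0 \<mu>1 = MW2 \<mu>0 \<mu>1" if "optimal_transport_map (\<lambda>x. A *v x + b) \<mu>0 \<mu>1" for A b
    using that by (intro W2_eq_MW2_affine_plan[OF G lin]) (auto simp: optimal_transport_map_def intro: INF_lower)
qed

end
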